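(* Let $X$ be a real separable Hilbert space, $(T_t)_{t\ge 0}$ a strongly continuous semigroup of bounded linear operators on $X$ with infinitesimal generator $A$, let $b\in X$, let $M$ be a Lévy measure on $X$, and let $(P_t)_{t\ge 0}$ be the generalised Mehler semigroup associated with $(T_t)_{t\ge0}$ and the characteristics $[b,0,M]$. Assume: (1) there is an orthonormal basis $\{h_n\mid n\in\mathbb N\}$ of $X$ consisting of eigenvectors of $A^*$, and $\int_{B_1^c}|x|\,M(dx)<\infty$; (2) the limit $b_\infty:=\lim_{t\to\infty}b_t$ exists in $X$; (3) $\int_0^\infty\int_X(1\wedge|T_sx|^2)\,M(dx)\,ds<\infty$; (4) $\lim_{t\to\infty}T_tx=0$ for every $x\in X$; (5) there is a function $h:(0,\infty)\to(0,\infty)$ with $h\in L^1((0,\infty))$ such that $h(t)M-M\circ T_t^{-1}$ is a positive measure for every $t>0$. Let $\sigma$ be the unique invariant probability measure of $(P_t)_{t\ge0}$, and for a Borel measure $\mu$ on $X$ and $p\ge1$ write $\mu(p):=\int_X|x|^p\mu(dx)$. Assume also $\sigma(1)<\infty$ and $M(1)<\infty$. Then: (i) if $M(2)<\infty$, then $\sigma(2)<\infty$; (ii) if $\sigma(2)<\infty$ and $M(p)<\infty$ for some $p>2$, then $\sigma(p)<\infty$.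
   Context: $X$ may be finite or infinite dimensional, with inner product $\langle\cdot,\cdot\rangle$ and norm $|\cdot|$; $X^*$ is identified with $X$; $B_1$ is the open unit ball centred at $0$ and $B_1^c$ its complement. $B_b(X)$ is the space of bounded Borel functions $X\to\mathbb R$. A Lévy measure on $X$ is a Borel measure $M$ with $M(\{0\})=0$ and $\int_X(1\wedge|x|^2)M(dx)<\infty$. For $T\in\mathcal L(X)$, $(M\circ T^{-1})(B)=M(T^{-1}(B))$. Mehler semigroup: set $\lambda(\xi)=-i\langle\xi,b\rangle-\int_X\big(e^{i\langle x,\xi\rangle}-1-i\langle x,\xi\rangle\chi_{B_1}(x)\big)M(dx)$. Standing assumption: $\lambda$ is continuous for the Sazonov topology (the topology generated by the seminorms $x\mapsto|Tx|$, $T$ Hilbert–Schmidt on $X$). For $t\ge0$, $\mu_t$ is the Borel probability measure on $X$ with characteristic function $\widehat{\mu_t}(\xi)=\exp\big(-\int_0^t\lambda(T_s^*\xi)ds\big)$, and $(P_tf)(x)=\int_Xf(T_tx+y)\mu_t(dy)$ for $f\in B_b(X)$. Moreover $$b_t=\int_0^tT_sb\,ds+\int_0^t\int_XT_sx\big(\chi_{B_1}(T_sx)-\chi_{B_1}(x)\big)M(dx)ds.$$ Invariant measure: a Borel probability measure $\sigma$ is invariant if $\int_XP_tf\,d\sigma=\int_Xf\,d\sigma$ for all $t\ge0$, $f\in B_b(X)$. Under (1)–(4) it is known that there is exactly one invariant measure $\sigma$; it is the infinitely divisible law with Lévy–Khinchine characteristics $[b_\infty,0,M_\infty]$, where $M_\infty(\{0\})=0$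 and $M_\infty(B)=\int_0^\infty M(T_s^{-1}(B))ds$ for Borel $B\not\ni0$; also $\mu_t\to\sigma$ weakly as $t\to\infty$. *)

theory Defs
  imports "HOL-Probability.Probability"
begin

text \<open>A separable real Hilbert space of arbitrary (finite or infinite) dimension is a type of class
  \<open>{real_inner, banach, second_countable_topology}\<close>. Families indexed by time are functions of a
  real parameter that are only constrained, and only used, at nonnegative times.\<close>

definition orthonormal_basis :: "'a::real_inner set \<Rightarrow> bool" where
  "orthonormal_basis E \<longleftrightarrow>
     pairwise orthogonal E \<and> (\<forall>e\<in>E. norm e = 1) \<and> closure (span E) = UNIV"

definition hilbert_schmidt :: "('a::real_inner \<Rightarrow> 'a) \<Rightarrow> bool" where
  "hilbert_schmidt S \<longleftrightarrow>
     bounded_linear S \<and> (\<exists>E. orthonormal_basis E \<and> (\<lambda>e. (norm (S e))\<^sup>2) summable_on E)"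

definition sazonov_topology :: "'a::real_inner topology" where
  "sazonov_topology =
     topology_generated_by {{y. norm (S (y - x)) < r} | S x r. hilbert_schmidt S \<and> r > 0}"

definition c0_semigroup :: "(real \<Rightarrow> 'a::real_normed_vector \<Rightarrow> 'a) \<Rightarrow> bool" where
  "c0_semigroup T \<longleftrightarrow>
     (\<forall>t\<ge>0. bounded_linear (T t)) \<and>
     (\<forall>x. T 0 x = x) \<and>
     (\<forall>s\<ge>0. \<forall>t\<ge>0. \<forall>x. T (s + t) x = T s (T t x)) \<and>
     (\<forall>x. ((\<lambda>t. T t x) \<longlongrightarrow> x) (at_right 0))"

definition gen_dom :: "(real \<Rightarrow> 'a::real_normed_vector \<Rightarrow> 'a) \<Rightarrow> 'a set" where
  "gen_dom T = {x. \<exists>y. ((\<lambda>t. (T t x - x) /\<^sub>R t) \<longlongrightarrow> y) (at_right 0)}"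

definition gen :: "(real \<Rightarrow> 'a::real_normed_vector \<Rightarrow> 'a) \<Rightarrow> 'a \<Rightarrow> 'a" where
  "gen T x = Lim (at_right 0) (\<lambda>t. (T t x - x) /\<^sub>R t)"

text \<open>The adjoint of an unbounded operator \<open>A\<close> with domain \<open>D\<close>. The value is unique when \<open>D\<close> is
  dense, as is the domain of a generator.\<close>

definition adj_dom :: "'a::real_inner set \<Rightarrow> ('a \<Rightarrow> 'a) \<Rightarrow> 'a set" where
  "adj_dom D A = {y. \<exists>z. \<forall>x\<in>D. A x \<bullet> y = x \<bullet> z}"

definition adj :: "'a::real_inner set \<Rightarrow> ('a \<Rightarrow> 'a) \<Rightarrow> 'a \<Rightarrow> 'a" where
  "adj D A y = (THE z. \<forall>x\<in>D. A x \<bullet> y = x \<bullet> z)"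

definition eigenvector_adj :: "'a::real_inner set \<Rightarrow> ('a \<Rightarrow> 'a) \<Rightarrow> 'a \<Rightarrow> bool" where
  "eigenvector_adj D A v \<longleftrightarrow> v \<noteq> 0 \<and> v \<in> adj_dom D A \<and> (\<exists>c::real. adj D A v = c *\<^sub>R v)"

definition levy_measure :: "'a::real_normed_vector measure \<Rightarrow> bool" where
  "levy_measure M \<longleftrightarrow>
     sets M = sets borel \<and> emeasure M {0} = 0 \<and>
     (\<integral>\<^sup>+x. ennreal (min 1 ((norm x)\<^sup>2)) \<partial>M) < \<infinity>"

definition levy_symbol ::
    "'a::{real_inner, banach, second_countable_topology} \<Rightarrow> 'a measure \<Rightarrow> 'a \<Rightarrow> complex" where
  "levy_symbol b M \<xi> =
     - \<i> * complex_of_real (\<xi> \<bullet> b)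
     - (\<integral>x. (iexp (x \<bullet> \<xi>) - 1
              - \<i> * complex_of_real ((x \<bullet> \<xi>) * indicator (ball 0 1) x)) \<partial>M)"

definition char_fun :: "'a::{real_inner, second_countable_topology} measure \<Rightarrow> 'a \<Rightarrow> complex" where
  "char_fun \<nu> \<xi> = (\<integral>y. iexp (y \<bullet> \<xi>) \<partial>\<nu>)"

definition mehler_measures ::
    "(real \<Rightarrow> 'a::{real_inner, banach, second_countable_topology} \<Rightarrow> 'a) \<Rightarrow> 'a \<Rightarrow> 'a measure
      \<Rightarrow> (real \<Rightarrow> 'a measure) \<Rightarrow> bool" where
  "mehler_measures T b M \<mu> \<longleftrightarrow>
     (\<forall>t\<ge>0. prob_space (\<mu> t) \<and> sets (\<mu> t) = sets borel \<and>
        (\<forall>\<xi>. char_fun (\<mu> t) \<xi> =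
               exp (- (LINT s:{0..t}|lborel. levy_symbol b M (adjoint (T s) \<xi>)))))"

definition mehler_semigroup ::
    "(real \<Rightarrow> 'a::{real_normed_vector, second_countable_topology} \<Rightarrow> 'a) \<Rightarrow> (real \<Rightarrow> 'a measure)
      \<Rightarrow> real \<Rightarrow> ('a \<Rightarrow> real) \<Rightarrow> 'a \<Rightarrow> real" where
  "mehler_semigroup T \<mu> t f x = (\<integral>y. f (T t x + y) \<partial>\<mu> t)"

definition drift ::
    "(real \<Rightarrow> 'a::{real_inner, banach, second_countable_topology} \<Rightarrow> 'a) \<Rightarrow> 'a \<Rightarrow> 'a measure
      \<Rightarrow> real \<Rightarrow> 'a" where
  "drift T b M t =
     (LINT s:{0..t}|lborel. T s b) +
     (LINT s:{0..t}|lborel.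
        (\<integral>x. (indicator (ball 0 1) (T s x) - indicator (ball 0 1) x :: real) *\<^sub>R T s x \<partial>M))"

definition invariant_measure ::
    "(real \<Rightarrow> ('a::topological_space \<Rightarrow> real) \<Rightarrow> 'a \<Rightarrow> real) \<Rightarrow> 'a measure \<Rightarrow> bool" where
  "invariant_measure P \<sigma> \<longleftrightarrow>
     prob_space \<sigma> \<and> sets \<sigma> = sets borel \<and>
     (\<forall>t\<ge>0. \<forall>f\<in>borel_measurable borel. bounded (range f) \<longrightarrow>
        (\<integral>x. P t f x \<partial>\<sigma>) = (\<integral>x. f x \<partial>\<sigma>))"

definition moment :: "'a::real_normed_vector measure \<Rightarrow> real \<Rightarrow> ennreal" where
  "moment \<nu> p = (\<integral>\<^sup>+x. ennreal (norm x powr p) \<partial>\<nu>)"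

text \<open>Positivity of \<open>c M - M \<circ> S\<inverse>\<close> is stated as domination on every Borel set, because \<open>M\<close> may take
  the value \<open>\<infinity>\<close>.\<close>

definition dominates_image :: "real \<Rightarrow> 'a::topological_space measure \<Rightarrow> ('a \<Rightarrow> 'a) \<Rightarrow> bool" where
  "dominates_image c M S \<longleftrightarrow>
     (\<forall>B\<in>sets borel. emeasure (distr M borel S) B \<le> ennreal c * emeasure M B)"

end

theory Submission
  imports Defs
begin

text \<open>Let \<open>Q = ds \<otimes> M(dx)\<close> on \<open>[0,\<infinity>) \<times> X\<close> and \<open>Z(s,x) = T\<^sub>s x\<close>. Domination (5) and \<open>M(p) < \<infinity>\<close> give
  \<open>\<integral>|Z|\<^sup>p dQ \<le> M(p) \<integral>h < \<infinity>\<close>, also for \<open>p = 1\<close>, so no compensation of small jumps is needed and the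
  characteristic function of \<open>\<sigma>\<close>, as the limit of those of \<open>\<mu>\<^sub>t\<close>, is
  \<open>exp (i\<langle>a,\<xi>\<rangle> + \<integral>(exp (i\<langle>Z,\<xi>\<rangle>) - 1) dQ)\<close> for some \<open>a\<close>. Since \<open>\<sigma>(1) < \<infinity>\<close> it can be differentiated,
  and uniqueness of characteristic functions turns the derivative into Stein's identity
  \<open>\<integral>\<langle>y - a, f y\<rangle> \<sigma>(dy) = \<integral>\<integral>\<langle>Z, f (Z + y)\<rangle> dQ \<sigma>(dy)\<close> for bounded Borel fields \<open>f\<close>. With
  \<open>f y = |y| powr (p - 2) y\<close> cut off outside a large ball this bounds \<open>\<sigma>(p)\<close> by \<open>\<sigma>(p - 1)\<close>, \<open>\<integral>|Z| dQ\<close> and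
  \<open>\<integral>|Z|\<^sup>p dQ\<close>, and the theorem follows by induction on \<open>p\<close> in steps of one.\<close>

text \<open>Only the first moment of \<open>\<sigma>\<close> is given, so its characteristic
  function may be differentiated just once. Stein's identity packs that single derivative into a
  statement about all bounded fields, and truncated fields then reach higher and fractional moments.
  The identity arises because the derivative of the exponent produces
  \<open>Z \<bullet> \<eta>\<close> times \<open>iexp (Z \<bullet> \<xi>)\<close>, and this
  exponential times the characteristic function of \<open>\<sigma>\<close> is that of
  \<open>Z + y\<close> with an independent jump \<open>Z\<close>; both sides become Fourier
  transforms of signed measures. Steps of one in p come from bounding |Z| |Z + y|^(p-1) by a
  multiple of |Z|^p + |Z| |y|^(p-1). The formula for the characteristic function follows from
  invariance: \<open>\<sigma>\<close> is the law of \<open>T t x + y\<close> with independent x of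
  law \<open>\<sigma>\<close> and y of law \<open>\<mu> t\<close>, and \<open>T t x\<close> tends to
  0. The vector \<open>a\<close> is the limiting drift after the compensator of the small jumps has
  been taken out. Since the dimension is arbitrary, uniqueness of characteristic functions is
  reduced to the line, one direction at a time.\<close>

section \<open>Bounded operators and strongly continuous semigroups\<close>

text \<open>Minimise the energy \<open>J\<close>. Completing the square bounds it below, the
  parallelogram law makes a minimising sequence Cauchy, and the vanishing first variation at the
  minimiser is the representation.\<close>

lemma riesz_representation:
  fixes \<phi> :: "'a::{real_inner, banach} \<Rightarrow> real"
  assumes "bounded_linear \<phi>"
  shows "\<exists>z. \<forall>x. \<phi> x = x \<bullet> z"
proof -
  interpret bounded_linear \<phi> by fact
  define J where "J x = (norm x)\<^sup>2 / 2 - \<phi> x" for x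
  define K where "K = onorm \<phi>"
  have K: "\<phi> x \<le> K * norm x" for x
    using onorm[OF assms, of x] unfolding K_def by (simp add: abs_le_iff)
  have J_ge: "- K\<^sup>2 / 2 \<le> J x" for x
  proof -
    have "0 \<le> (norm x - K)\<^sup>2" by simp
    then show ?thesis using K[of x] unfolding J_def by (simp add: power2_diff algebra_simps)
  qed
  have bdd: "bdd_below (range J)" using J_ge by (auto intro!: bdd_belowI)
  define m where "m = Inf (range J)"
  have m_le: "m \<le> J x" for x unfolding m_def by (rule cInf_lower[OF _ bdd]) simp
  have "\<exists>x. J x < m + 1 / real (Suc n)" for n
    using cInf_lessD[of "range J" "m + 1 / real (Suc n)"] unfolding m_def by force
  then obtain X where X: "\<And>n. J (X n) < m + 1 / real (Suc n)" by metis
  \<comment> \<open>The parallelogram law: the midpoint of two almost minimisers has energy at least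
    \<open>m\<close>, which forces them to be close.\<close>
  have mid: "J ((1/2) *\<^sub>R (x + y)) = (J x + J y) / 2 - (norm (x - y))\<^sup>2 / 8" for x y
    unfolding J_def add scaleR power2_norm_eq_inner real_scaleR_def inner_simps inner_commute[of y x]
    by (simp add: field_simps)
  have dist: "(norm (x - y))\<^sup>2 \<le> 4 * ((J x - m) + (J y - m))" for x y
    using m_le[of "(1/2) *\<^sub>R (x + y)"] unfolding mid by (simp add: field_simps)
  have "Cauchy X"
  proof (rule CauchyI)
    fix e :: real assume "0 < e"
    \<comment> \<open>Two terms beyond N have energy within 1/N of \<open>m\<close>, so
      \<open>dist\<close> gives a squared distance below 4 * (2/N) = 8/N.\<close>
    then obtain N where N: "8 / e\<^sup>2 < real N" using reals_Archimedean2 by blast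
    then have "0 < real N" using \<open>0 < e\<close>
      by (meson divide_pos_pos dual_order.strict_trans zero_less_numeral zero_less_power)
    have "norm (X i - X j) < e" if "N \<le> i" "N \<le> j" for i j
    proof -
      have "J (X i) - m < 1 / real N" "J (X j) - m < 1 / real N"
        using X[of i] X[of j] that \<open>0 < real N\<close>
        by (smt (verit) frac_le of_nat_Suc of_nat_le_iff)+
      then have "(norm (X i - X j))\<^sup>2 < 8 / real N" using dist[of "X i" "X j"] by simp
      also have "\<dots> < e\<^sup>2" using N \<open>0 < e\<close> \<open>0 < real N\<close> by (simp add: field_simps)
      finally show ?thesis by (rule power2_less_imp_less) (use \<open>0 < e\<close> in simp)
    qed
    then show "\<exists>M. \<forall>m\<ge>M. \<forall>n\<ge>M. norm (X m - X n) < e" by blast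
  qed
  then obtain z where z: "X \<longlonglongrightarrow> z" using Cauchy_convergent_iff convergent_def by blast
  have "(\<lambda>n. J (X n)) \<longlonglongrightarrow> J z"
    unfolding J_def by (intro tendsto_intros tendsto z) simp
  moreover have "(\<lambda>n. m + 1 / real (Suc n)) \<longlonglongrightarrow> m + 0"
    by (intro tendsto_intros LIMSEQ_Suc[OF lim_1_over_n])
  ultimately have "J z \<le> m"
    using LIMSEQ_le[of "\<lambda>n. J (X n)" "J z" "\<lambda>n. m + 1 / real (Suc n)" m] X less_imp_le by auto
  have "\<phi> h = h \<bullet> z" for h
  proof (cases "h = 0")
    case False
    \<comment> \<open>\<open>d\<close> is the derivative of \<open>J\<close> at \<open>z\<close> in
      the direction \<open>h\<close>, and the \<open>t\<close> below minimises the quadratic t d +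
      t^2 |h|^2 / 2.\<close>
    define d where "d = h \<bullet> z - \<phi> h"
    define t where "t = - d / (norm h)\<^sup>2"
    have "J z \<le> J (z + t *\<^sub>R h)" using \<open>J z \<le> m\<close> m_le order_trans by blast
    then have "0 \<le> t * d + t\<^sup>2 * (norm h)\<^sup>2 / 2"
      unfolding J_def d_def add scaleR power2_norm_eq_inner real_scaleR_def inner_simps
        inner_commute[of z h]
      by (simp add: field_simps power2_eq_square)
    also have "\<dots> = - (d\<^sup>2 / (2 * (norm h)\<^sup>2))"
      using False unfolding t_def by (simp add: field_simps power2_eq_square)
    finally have "d\<^sup>2 / (2 * (norm h)\<^sup>2) \<le> 0" by simp
    then have "d = 0" using False by (simp add: divide_le_0_iff)
    then show ?thesis unfolding d_def by simp
  qed (simp add: zero)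
  then show ?thesis by blast
qed

text \<open>\<open>adjoint\<close> is a choice operator, so it has its defining property as soon as
  some adjoint exists; the Riesz representation supplies one.\<close>

lemma adjoint_inner:
  fixes f :: "'a::{real_inner, banach} \<Rightarrow> 'b::real_inner"
  assumes "bounded_linear f"
  shows "x \<bullet> adjoint f y = f x \<bullet> y"
proof -
  have "\<exists>z. \<forall>x. f x \<bullet> y = x \<bullet> z" for y
    by (intro riesz_representation bounded_linear_intros assms)
  then have "\<exists>g. \<forall>x y. f x \<bullet> y = x \<bullet> g y" by metis
  then have "\<forall>x y. f x \<bullet> y = x \<bullet> adjoint f y" unfolding adjoint_def by (rule someI_ex)
  then show ?thesis by metis
qed

text \<open>Supplies the humps for the uniform boundedness principle: homogeneity allows a vector
  that almost attains the operator norm to have any prescribed length.\<close>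

lemma onorm_attained_near:
  assumes "bounded_linear f" "0 \<le> c" "c < onorm f" "0 < r"
  obtains h where "norm h = r" "c * r < norm (f h)"
proof -
  interpret bounded_linear f by fact
  obtain x where x: "c * norm x < norm (f x)"
    using onorm_bound[OF assms(2), of f] assms(3) by (meson not_le)
  then have "x \<noteq> 0" by (auto simp: zero)
  show thesis
  proof (rule that)
    show "norm ((r / norm x) *\<^sub>R x) = r" using \<open>x \<noteq> 0\<close> assms(4) by simp
    have "c * r = (r / norm x) * (c * norm x)" using \<open>x \<noteq> 0\<close> by simp
    also have "\<dots> < (r / norm x) * norm (f x)"
      using x \<open>x \<noteq> 0\<close> assms(4) by (intro mult_strict_left_mono) auto
    finally show "c * r < norm (f ((r / norm x) *\<^sub>R x))" using assms(4) by (simp add: scaleR)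
  qed
qed

text \<open>Gliding hump: one of \<open>x + h\<close> and \<open>x - h\<close> has an image at least as long as that of \<open>h\<close>.\<close>

lemma uniform_boundedness:
  fixes F :: "'i \<Rightarrow> 'a::banach \<Rightarrow> 'b::real_normed_vector"
  assumes lin: "\<And>i. i \<in> I \<Longrightarrow> bounded_linear (F i)"
    and bdd: "\<And>x. \<exists>C. \<forall>i\<in>I. norm (F i x) \<le> C"
  shows "\<exists>K. \<forall>i\<in>I. onorm (F i) \<le> K"
proof (rule ccontr)
  assume "\<not> ?thesis"
  \<comment> \<open>Norms beyond 4^n beat humps of length 3^(-n): the images grow like (4/3)^n
    although the humps are summable.\<close>
  then have "\<forall>n::nat. \<exists>i. i \<in> I \<and> 4 ^ n < onorm (F i)" by (force simp: not_le)
  from choice[OF this] obtain k where "\<forall>n::nat. k n \<in> I \<and> 4 ^ n < onorm (F (k n))" ..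
  then have k: "\<And>n. k n \<in> I" and k4: "\<And>n::nat. 4 ^ n < onorm (F (k n))" by simp_all
  have pos: "0 < onorm (F (k n))" for n 
    by (rule less_trans[OF _ k4]) simp
  have "\<exists>h. norm h = (1/3) ^ n \<and> (2/3) * onorm (F (k n)) * (1/3) ^ n \<le> norm (F (k n) (x + h))"
    for x n
  proof -
    obtain h where h: "norm h = (1/3::real) ^ n"
        "(2/3) * onorm (F (k n)) * (1/3) ^ n < norm (F (k n) h)"
      using onorm_attained_near[OF lin[OF k], of "(2/3) * onorm (F (k n))" n "(1/3) ^ n"] pos[of n]
      by auto
    interpret bounded_linear "F (k n)" by (rule lin[OF k])
    have "2 *\<^sub>R F (k n) h = F (k n) (x + h) - F (k n) (x + - h)"
      by (simp add: add diff scaleR_2)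
    then have "2 * norm (F (k n) h) \<le> norm (F (k n) (x + h)) + norm (F (k n) (x + - h))"
      by (metis norm_scaleR norm_triangle_ineq4 abs_numeral)
    then have "norm (F (k n) h) \<le> norm (F (k n) (x + h)) \<or>
        norm (F (k n) h) \<le> norm (F (k n) (x + - h))" by linarith
    then show ?thesis
    proof
      assume "norm (F (k n) h) \<le> norm (F (k n) (x + h))"
      with h show ?thesis by (intro exI[of _ h]) simp
    next
      assume "norm (F (k n) h) \<le> norm (F (k n) (x + - h))"
      with h show ?thesis by (intro exI[of _ "- h"]) simp
    qed
  qed
  then obtain g where g: "\<And>n x. norm (g n x) = (1/3) ^ n"
      "\<And>n x. (2/3) * onorm (F (k n)) * (1/3) ^ n \<le> norm (F (k n) (x + g n x))"
    by metis
  define X where "X = rec_nat 0 (\<lambda>n x. x + g n x)"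
  define d where "d n = g n (X n)" for n
  have X_Suc: "X (Suc n) = X n + d n" for n unfolding X_def d_def by simp
  have X_sum: "X n = (\<Sum>i<n. d i)" for n
    by (induction n) (simp_all add: X_Suc, simp add: X_def)
  have nd: "norm (d n) = (1/3) ^ n" for n unfolding d_def by (rule g)
  have sum_nd: "summable (\<lambda>n. norm (d n))" unfolding nd by (rule summable_geometric) simp
  note sum_d = summable_norm_cancel[OF sum_nd]
  define x where "x = (\<Sum>n. d n)"
  \<comment> \<open>All humps after the n-th together have length at most half of 3^(-n). The n-th
    partial sum has an image of at least 2/3 of onorm * 3^(-n), so passing to the limit
    \<open>x\<close> leaves the fraction 2/3 - 1/2 = 1/6.\<close>
  have near: "norm (x - X (Suc n)) \<le> (1/2) * (1/3) ^ n" for n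
  proof -
    have "x - X (Suc n) = (\<Sum>i. d (i + Suc n))"
      unfolding x_def X_sum using suminf_split_initial_segment[OF sum_d, of "Suc n"] by simp
    also have "norm \<dots> \<le> (\<Sum>i. norm (d (i + Suc n)))"
      by (rule summable_norm) (rule summable_ignore_initial_segment[OF sum_nd])
    also have "\<dots> = (\<Sum>i. (1/3) ^ Suc n * (1/3) ^ i)" unfolding nd by (simp add: power_add mult_ac)
    also have "\<dots> = (1/3) ^ Suc n * (\<Sum>i. (1/3) ^ i)"
      by (rule suminf_mult) (simp add: summable_geometric)
    also have "\<dots> = (1/2) * (1/3) ^ n" by (simp add: suminf_geometric)
    finally show ?thesis .
  qed
  have "(1/6) * (4/3) ^ n \<le> norm (F (k n) x)" for n
  proof -
    interpret bounded_linear "F (k n)" by (rule lin[OF k])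
    have "norm (F (k n) (X (Suc n))) \<le> norm (F (k n) x) + norm (F (k n) (x - X (Suc n)))"
      unfolding diff by norm
    moreover have "norm (F (k n) (x - X (Suc n))) \<le> onorm (F (k n)) * ((1/2) * (1/3) ^ n)"
      by (rule order_trans[OF onorm[OF lin[OF k]] mult_left_mono[OF near]]) (simp add: pos less_imp_le)
    moreover have "(2/3) * onorm (F (k n)) * (1/3) ^ n \<le> norm (F (k n) (X (Suc n)))"
      unfolding X_Suc d_def by (rule g)
    ultimately have "(1/6) * (onorm (F (k n)) * (1/3) ^ n) \<le> norm (F (k n) x)"
      by (simp add: algebra_simps)
    moreover have "4 ^ n * (1/3) ^ n \<le> onorm (F (k n)) * (1/3) ^ n"
      using k4[of n] by (intro mult_right_mono) auto
    moreover have "4 ^ n * (1/3) ^ n = (4/3::real) ^ n" by (simp add: power_divide)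
    ultimately show ?thesis by linarith
  qed
  note growth = this
  obtain C where C: "\<And>n. norm (F (k n) x) \<le> C" using bdd[of x] k by blast
  obtain n where "6 * C < (4/3::real) ^ n" using real_arch_pow[of "4/3" "6 * C"] by auto
  with growth[of n] C[of n] show False by simp
qed

section \<open>Local boundedness of strongly continuous semigroups\<close>

lemma c0_semigroup_bounded_linear: "c0_semigroup T \<Longrightarrow> 0 \<le> t \<Longrightarrow> bounded_linear (T t)"
  by (simp add: c0_semigroup_def)

lemma c0_semigroup_add:
  "c0_semigroup T \<Longrightarrow> 0 \<le> s \<Longrightarrow> 0 \<le> t \<Longrightarrow> T (s + t) x = T s (T t x)"
  by (simp add: c0_semigroup_def)

text \<open>Otherwise there are times \<open>s n\<close> tending to 0 with operator norms above n,
  while \<open>T (s n) x\<close> converges for each fixed x; this contradicts uniform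
  boundedness.\<close>

lemma c0_semigroup_bounded_near_0:
  fixes T :: "real \<Rightarrow> 'a::banach \<Rightarrow> 'a"
  assumes T: "c0_semigroup T"
  obtains d K where "0 < d" "\<And>s x. 0 \<le> s \<Longrightarrow> s \<le> d \<Longrightarrow> norm (T s x) \<le> K * norm x"
proof (rule ccontr)
  assume neg: "\<not> thesis"
  have "\<exists>s. 0 \<le> s \<and> s \<le> 1 / real (Suc n) \<and> real n < onorm (T s)" for n
  proof (rule ccontr)
    assume "\<not> ?thesis"
    then have "norm (T s x) \<le> real n * norm x" if "0 \<le> s" "s \<le> 1 / real (Suc n)" for s x
      using that onorm[OF c0_semigroup_bounded_linear[OF T that(1)], of x]
      by (meson mult_right_mono norm_ge_zero not_le order_trans)
    then show False using neg that[of "1 / real (Suc n)" "real n"] by simp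
  qed
  then obtain s where s: "\<And>n. 0 \<le> s n" "\<And>n. s n \<le> 1 / real (Suc n)"
      "\<And>n. real n < onorm (T (s n))" by metis
  have "s \<longlonglongrightarrow> 0"
    by (rule tendsto_sandwich[OF _ _ tendsto_const LIMSEQ_Suc[OF lim_1_over_n]])
       (use s in \<open>auto intro!: always_eventually\<close>)
  have "\<exists>C. \<forall>n\<in>UNIV. norm (T (s n) x) \<le> C" for x
  proof -
    have "((\<lambda>t. T t x) \<longlongrightarrow> T 0 x) (at_right 0)" and "T 0 x = x"
      using T by (simp_all add: c0_semigroup_def)
    then have "continuous (at 0 within {0..}) (\<lambda>t. T t x)"
      by (simp add: continuous_within at_within_Ici_at_right)
    then have "(\<lambda>n. T (s n) x) \<longlonglongrightarrow> T 0 x"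
      using s(1) \<open>s \<longlonglongrightarrow> 0\<close> by (simp add: continuous_within_sequentially o_def)
    then have "Bseq (\<lambda>n. T (s n) x)" by (intro convergent_imp_Bseq convergentI)
    then show ?thesis by (auto simp: Bseq_def)
  qed
  from uniform_boundedness[of UNIV "\<lambda>n. T (s n)", OF _ this]
  obtain K where "\<And>n. onorm (T (s n)) \<le> K"
    using c0_semigroup_bounded_linear[OF T s(1)] by auto
  then show False using s(3) reals_Archimedean2[of K] by (meson less_le_trans not_less order_less_trans)
qed

text \<open>Cut the time interval into pieces of length d and multiply the bounds given by the
  semigroup law.\<close>

lemma c0_semigroup_locally_bounded:
  fixes T :: "real \<Rightarrow> 'a::banach \<Rightarrow> 'a"
  assumes T: "c0_semigroup T"
  obtains K where "\<And>s x. 0 \<le> s \<Longrightarrow> s \<le> t \<Longrightarrow> norm (T s x) \<le> K * norm x"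
proof -
  obtain d K0 where d: "0 < d" and K0: "\<And>s x. 0 \<le> s \<Longrightarrow> s \<le> d \<Longrightarrow> norm (T s x) \<le> K0 * norm x"
    using c0_semigroup_bounded_near_0[OF T] by metis
  \<comment> \<open>With \<open>K\<close> at least 1 its powers increase, so the bound for a longer
    interval also covers the short times.\<close>
  define K where "K = max 1 K0"
  have K: "norm (T s x) \<le> K * norm x" if "0 \<le> s" "s \<le> d" for s x
    using K0[OF that, of x] mult_right_mono[of K0 K "norm x"] unfolding K_def by simp
  have "\<And>s x. 0 \<le> s \<Longrightarrow> s \<le> real n * d \<Longrightarrow> norm (T s x) \<le> K ^ Suc n * norm x" for n
  proof (induction n)
    case 0
    then show ?case using K[of 0 x] d by simp
  next
    case (Suc n)
    show ?case
    proof (cases "s \<le> d")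
      case True
      have "1 \<le> K ^ Suc n" unfolding K_def by (rule one_le_power) simp
      moreover have "1 \<le> K" by (simp add: K_def)
      ultimately have "K * 1 \<le> K * K ^ Suc n" by (intro mult_left_mono) auto
      then have "K * norm x \<le> K ^ Suc (Suc n) * norm x" by (intro mult_right_mono) auto
      with K[OF Suc.prems(1) True, of x] show ?thesis by linarith
    next
      case False
      then have "T s x = T d (T (s - d) x)" using c0_semigroup_add[OF T, of d "s - d" x] d by simp
      also have "norm \<dots> \<le> K * norm (T (s - d) x)" using d by (intro K) auto
      also have "\<dots> \<le> K * (K ^ Suc n * norm x)"
        using False Suc.prems by (intro mult_left_mono Suc.IH) (auto simp: K_def algebra_simps)
      finally show ?thesis by (simp add: mult_ac)
    qed
  qed
  moreover obtain n where "t \<le> real n * d" using d by (metis ex_less_of_nat_mult less_imp_le)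
  ultimately show thesis using that by (meson order_trans)
qed

section \<open>Uniqueness of characteristic functions on a Hilbert space\<close>

text \<open>The value at 0 shows that both masses agree. Dividing by the common mass leads to Levy's
  uniqueness theorem for probability measures; mass zero is separate.\<close>

lemma finite_real_measure_eqI_char:
  fixes M N :: "real measure"
  assumes "finite_measure M" "finite_measure N"
    and [measurable_cong]: "sets M = sets borel" "sets N = sets borel"
    and char: "\<And>t. char M t = char N t"
  shows "M = N"
proof -
  interpret M: finite_measure M by fact
  interpret N: finite_measure N by fact
  have sp: "space M = UNIV" "space N = UNIV"
    using sets_eq_imp_space_eq[OF assms(3)] sets_eq_imp_space_eq[OF assms(4)] by simp_all
  define m where "m = measure M UNIV"
  have "complex_of_real (measure M UNIV) = complex_of_real (measure N UNIV)"
    using char[of 0] by (simp add: char_def sp scaleR_conv_of_real)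
  then have m: "measure M UNIV = m" "measure N UNIV = m" by (simp_all add: m_def)
  have em: "emeasure M UNIV = ennreal m" "emeasure N UNIV = ennreal m"
    using m M.emeasure_eq_measure N.emeasure_eq_measure by simp_all
  show ?thesis
  proof (cases "m = 0")
    case True
    show ?thesis
    proof (rule measure_eqI)
      fix A assume "A \<in> sets M"
      then have "emeasure M A \<le> 0" "emeasure N A \<le> 0"
        using emeasure_mono[of A UNIV M] emeasure_mono[of A UNIV N] em True
        by (simp_all add: assms(3,4))
      then show "emeasure M A = emeasure N A" by simp
    qed (simp add: assms)
  next
    case False
    then have "0 < m" using m measure_nonneg[of M UNIV] by simp
    let ?d = "\<lambda>K. density K (\<lambda>_. ennreal (1 / m))"
    have "real_distribution (?d K)"
      if [measurable_cong]: "sets K = sets borel" and "emeasure K UNIV = ennreal m" for K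
    proof -
      have "space K = UNIV" using sets_eq_imp_space_eq[OF that(1)] by simp
      then have "prob_space (?d K)"
        using that \<open>0 < m\<close> by (intro prob_spaceI) (simp add: emeasure_density nn_integral_cmult
          ennreal_mult'[symmetric] flip: ennreal_1)
      then show ?thesis
        using that \<open>space K = UNIV\<close> by (intro real_distribution.intro real_distribution_axioms.intro) auto
    qed
    moreover have "char (?d M) = char (?d N)"
    proof
      fix t
      have "char (?d M) t = (1 / m) *\<^sub>R char M t" "char (?d N) t = (1 / m) *\<^sub>R char N t"
        unfolding char_def using \<open>0 < m\<close> by (subst integral_density; simp)+
      then show "char (?d M) t = char (?d N) t" using char by simp
    qed
    ultimately have eq: "?d M = ?d N" using em assms(3,4) by (intro Levy_uniqueness) auto
    show ?thesis
    proof (rule measure_eqI)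
      fix A assume A: "A \<in> sets M"
      have "emeasure (?d M) A = emeasure (?d N) A" using eq by simp
      then have "ennreal (1 / m) * emeasure M A = ennreal (1 / m) * emeasure N A"
        using A assms(3,4) by (simp add: emeasure_density nn_integral_cmult)
      then have "ennreal m * (ennreal (1 / m) * emeasure M A) =
          ennreal m * (ennreal (1 / m) * emeasure N A)" by simp
      then show "emeasure M A = emeasure N A"
        using \<open>0 < m\<close> by (simp add: mult.assoc[symmetric] ennreal_mult[symmetric])
    qed (simp add: assms)
  qed
qed

text \<open>Give each measure the density \<open>g\<close> and project it along
  \<open>\<zeta>\<close>: the characteristic function of the resulting measure on the line at
  \<open>t\<close> is the \<open>g\<close>-weighted one at \<open>t *\<^sub>R \<zeta>\<close>. The
  weight is what later brings in a second direction.\<close>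

lemma integral_half_space_eqI:
  fixes M N :: "'a::{real_inner, second_countable_topology} measure"
  assumes "finite_measure M" "finite_measure N"
    and [measurable_cong]: "sets M = sets borel" "sets N = sets borel"
    and [measurable]: "g \<in> borel_measurable borel" and g: "\<And>y. 0 \<le> g y" "\<And>y. g y \<le> C"
    and char: "\<And>\<eta>. (\<integral>y. g y *\<^sub>R iexp (y \<bullet> \<eta>) \<partial>M) = (\<integral>y. g y *\<^sub>R iexp (y \<bullet> \<eta>) \<partial>N)"
    and [measurable]: "B \<in> sets borel"
  shows "(\<integral>y. g y * indicator B (y \<bullet> \<zeta>) \<partial>M) = (\<integral>y. g y * indicator B (y \<bullet> \<zeta>) \<partial>N)"
proof -
  define D where "D K = distr (density K (\<lambda>y. ennreal (g y))) borel (\<lambda>y. y \<bullet> \<zeta>)" for K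
  have fin: "finite_measure (D K)"
    if "finite_measure K" and [measurable_cong]: "sets K = sets borel" for K
  proof -
    interpret finite_measure K by fact
    have "(\<integral>\<^sup>+y. ennreal (g y) \<partial>K) \<le> (\<integral>\<^sup>+y. ennreal C \<partial>K)"
      by (intro nn_integral_mono ennreal_leI g)
    also have "\<dots> < \<infinity>"
      using emeasure_finite by (simp add: ennreal_mult_eq_top_iff less_top[symmetric])
    finally show ?thesis
      unfolding D_def by (intro finite_measureI)
        (simp add: emeasure_distr emeasure_density cong: nn_integral_cong)
  qed
  have char_D: "char (D K) t = (\<integral>y. g y *\<^sub>R iexp (y \<bullet> (t *\<^sub>R \<zeta>)) \<partial>K)"
    if [measurable_cong]: "sets K = sets borel" for K t
    unfolding char_def D_def
    by (subst integral_distr, simp, simp, subst integral_density) (auto simp: g mult.commute)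
  have meas_D: "measure (D K) B = (\<integral>y. g y * indicator B (y \<bullet> \<zeta>) \<partial>K)"
    if [measurable_cong]: "sets K = sets borel" for K
  proof -
    have "measure (D K) B = (\<integral>x. indicator B x \<partial>D K)" by (simp add: D_def)
    also have "\<dots> = (\<integral>y. g y *\<^sub>R indicator B (y \<bullet> \<zeta>) \<partial>K)"
      unfolding D_def by (subst integral_distr, simp, simp, subst integral_density) (auto simp: g)
    finally show ?thesis by simp
  qed
  have "D M = D N"
  proof (rule finite_real_measure_eqI_char)
    show "char (D M) t = char (D N) t" for t
      unfolding char_D[OF assms(3)] char_D[OF assms(4)] by (rule char)
  qed (use fin assms in \<open>auto simp: D_def\<close>)
  then show ?thesis using meas_D[OF assms(3)] meas_D[OF assms(4)] by simp
qed

lemma integrable_iexp_inner: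
  fixes M :: "'a::{real_inner, second_countable_topology} measure"
  assumes "finite_measure M" and [measurable_cong]: "sets M = sets borel"
  shows "integrable M (\<lambda>y. iexp (y \<bullet> \<xi>))"
  using assms(1) by (intro finite_measure.integrable_const_bound[where B = 1]) auto

text \<open>The induction step for uniqueness: a constraint in one direction can be imposed on both
  measures without losing equality of characteristic functions. The wave in direction
  \<open>\<xi>\<close> is treated as a weight and the constraint on
  \<open>y \<bullet> \<zeta>\<close> by uniqueness on the line.\<close>

lemma char_fun_density_half_space_eqI:
  fixes M N :: "'a::{real_inner, second_countable_topology} measure"
  assumes fin: "finite_measure M" "finite_measure N"
    and sets [measurable_cong]: "sets M = sets borel" "sets N = sets borel"
    and char: "\<And>\<xi>. char_fun M \<xi> = char_fun N \<xi>"
    and [measurable]: "B \<in> sets borel"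
  shows "char_fun (density M (indicator {y. y \<bullet> \<zeta> \<in> B})) \<xi> =
    char_fun (density N (indicator {y. y \<bullet> \<zeta> \<in> B})) \<xi>"
proof -
  \<comment> \<open>Adding 1 makes the cosine a nonnegative weight; the constant is subtracted again
    in \<open>cos\<close>. Written with exponentials, the weighted characteristic function at
    \<open>\<eta>\<close> involves only the values of \<open>char_fun\<close> at
    \<open>\<eta>\<close>, \<open>\<eta> + \<xi>\<close> and \<open>\<eta> - \<xi>\<close>.\<close>
  have wave: "(\<integral>y. (1 + cos (y \<bullet> \<xi> + c)) * indicator B (y \<bullet> \<zeta>) \<partial>M) =
      (\<integral>y. (1 + cos (y \<bullet> \<xi> + c)) * indicator B (y \<bullet> \<zeta>) \<partial>N)" for \<xi> c
  proof (rule integral_half_space_eqI[OF fin sets])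
    have *: "(\<integral>y. (1 + cos (y \<bullet> \<xi> + c)) *\<^sub>R iexp (y \<bullet> \<eta>) \<partial>K) =
        char_fun K \<eta> + (iexp c * char_fun K (\<eta> + \<xi>) + iexp (- c) * char_fun K (\<eta> - \<xi>)) / 2"
      if "finite_measure K" and s: "sets K = sets borel" for K \<eta>
    proof -
      have "(1 + cos (a + c)) *\<^sub>R iexp b =
          iexp b + (iexp c * iexp (b + a) + iexp (- c) * iexp (b - a)) / 2" for a b :: real
        by (simp add: scaleR_conv_of_real cos_of_real[symmetric] cos_exp_eq algebra_simps
            exp_add[symmetric] exp_minus[symmetric] add_divide_distrib)
      then have "(\<integral>y. (1 + cos (y \<bullet> \<xi> + c)) *\<^sub>R iexp (y \<bullet> \<eta>) \<partial>K) =
          (\<integral>y. iexp (y \<bullet> \<eta>) + (iexp c * iexp (y \<bullet> (\<eta> + \<xi>)) + iexp (- c) * iexp (y \<bullet> (\<eta> - \<xi>))) / 2 \<partial>K)"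
        by (simp only: inner_add_right inner_diff_right)
      also have "\<dots> = char_fun K \<eta> +
          (iexp c * char_fun K (\<eta> + \<xi>) + iexp (- c) * char_fun K (\<eta> - \<xi>)) / 2"
        using integrable_iexp_inner[OF that] unfolding char_fun_def
        by simp
      finally show ?thesis .
    qed
    show "(\<integral>y. (1 + cos (y \<bullet> \<xi> + c)) *\<^sub>R iexp (y \<bullet> \<eta>) \<partial>M) =
        (\<integral>y. (1 + cos (y \<bullet> \<xi> + c)) *\<^sub>R iexp (y \<bullet> \<eta>) \<partial>N)" for \<eta>
      using *[OF fin(1) sets(1)] *[OF fin(2) sets(2)] char by simp
    show "0 \<le> 1 + cos (y \<bullet> \<xi> + c)" for y using cos_ge_minus_one[of "y \<bullet> \<xi> + c"] by linarith
    show "1 + cos (y \<bullet> \<xi> + c) \<le> 2" for y by simp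
  qed measurable
  have const: "(\<integral>y. (1::real) * indicator B (y \<bullet> \<zeta>) \<partial>M) = (\<integral>y. 1 * indicator B (y \<bullet> \<zeta>) \<partial>N)"
    using char by (intro integral_half_space_eqI[OF fin sets, where g = "\<lambda>_. 1" and C = 1])
      (auto simp: char_fun_def)
  have int: "integrable K (\<lambda>y. f (y \<bullet> \<eta>) * indicator B (y \<bullet> \<zeta>))"
    if "finite_measure K" and [measurable_cong]: "sets K = sets borel"
      and [measurable]: "f \<in> borel_measurable borel" and "\<And>u. \<bar>f u\<bar> \<le> 1"
    for K and f :: "real \<Rightarrow> real" and \<eta>
    using that(1,4)
    by (intro finite_measure.integrable_const_bound[where B = 1]) (auto simp: indicator_def)
  have split: "(\<integral>y. (1 + cos (y \<bullet> \<eta> + c)) * indicator B (y \<bullet> \<zeta>) \<partial>K) =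
      (\<integral>y. 1 * indicator B (y \<bullet> \<zeta>) \<partial>K) + (\<integral>y. cos (y \<bullet> \<eta> + c) * indicator B (y \<bullet> \<zeta>) \<partial>K)"
    if "finite_measure K" "sets K = sets borel" for K \<eta> c
    using int[OF that, of "\<lambda>u. 1" 0] int[OF that, of "\<lambda>u. cos (u + c)" \<eta>]
    unfolding distrib_right by (intro Bochner_Integration.integral_add) auto
  have cos: "(\<integral>y. cos (y \<bullet> \<eta> + c) * indicator B (y \<bullet> \<zeta>) \<partial>M) =
      (\<integral>y. cos (y \<bullet> \<eta> + c) * indicator B (y \<bullet> \<zeta>) \<partial>N)" for \<eta> c
    using wave[of \<eta> c] split[OF fin(1) sets(1)] split[OF fin(2) sets(2)] const by simp
  \<comment> \<open>The phase \<open>c\<close> serves here: cos (pi/2 - u) = sin u.\<close>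
  have sin: "(\<integral>y. sin (y \<bullet> \<xi>) * indicator B (y \<bullet> \<zeta>) \<partial>M) =
      (\<integral>y. sin (y \<bullet> \<xi>) * indicator B (y \<bullet> \<zeta>) \<partial>N)"
    using cos[of "- \<xi>" "pi / 2"] by (simp add: sin_cos_eq)
  have *: "char_fun (density K (indicator {y. y \<bullet> \<zeta> \<in> B})) \<xi> =
      Complex (\<integral>y. cos (y \<bullet> \<xi> + 0) * indicator B (y \<bullet> \<zeta>) \<partial>K) (\<integral>y. sin (y \<bullet> \<xi>) * indicator B (y \<bullet> \<zeta>) \<partial>K)"
    if "finite_measure K" and s [measurable_cong]: "sets K = sets borel" for K
  proof -
    have "char_fun (density K (indicator {y. y \<bullet> \<zeta> \<in> B})) \<xi> =
        char_fun (density K (\<lambda>y. ennreal (indicator B (y \<bullet> \<zeta>)))) \<xi>"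
      by (auto intro!: arg_cong[where f = "\<lambda>d. char_fun (density K d) \<xi>"] simp: indicator_def)
    also have "\<dots> = (\<integral>y. indicator B (y \<bullet> \<zeta>) *\<^sub>R iexp (y \<bullet> \<xi>) \<partial>K)"
      unfolding char_fun_def by (subst integral_density) auto
    also have "\<dots> = (\<integral>y. complex_of_real (cos (y \<bullet> \<xi> + 0) * indicator B (y \<bullet> \<zeta>)) +
        \<i> * complex_of_real (sin (y \<bullet> \<xi>) * indicator B (y \<bullet> \<zeta>)) \<partial>K)"
      by (intro Bochner_Integration.integral_cong)
         (auto simp: scaleR_conv_of_real cis_conv_exp[symmetric] complex_eq_iff)
    also have "\<dots> = complex_of_real (\<integral>y. cos (y \<bullet> \<xi> + 0) * indicator B (y \<bullet> \<zeta>) \<partial>K) +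
        \<i> * complex_of_real (\<integral>y. sin (y \<bullet> \<xi>) * indicator B (y \<bullet> \<zeta>) \<partial>K)"
      using int[OF that, of "\<lambda>u. cos (u + 0)" \<xi>] int[OF that, of sin \<xi>]
      by (subst Bochner_Integration.integral_add) (auto simp del: of_real_mult)
    finally show ?thesis by (simp add: complex_eq_iff)
  qed
  show ?thesis
    using *[OF fin(1) sets(1)] *[OF fin(2) sets(2)] cos[of \<xi> 0] sin by simp
qed

section \<open>Cylinder sets and the Borel sigma-algebra\<close>

definition cylinder :: "('a::real_inner \<times> real set) list \<Rightarrow> 'a set" where
  "cylinder L = {y. \<forall>(\<zeta>, B)\<in>set L. y \<bullet> \<zeta> \<in> B}"

definition cylinders :: "'a::real_inner set set" where
  "cylinders = {cylinder L | L. \<forall>(\<zeta>, B)\<in>set L. B \<in> sets borel}"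

lemma cylinder_Nil: "cylinder [] = UNIV"
  by (simp add: cylinder_def)

lemma cylinder_Cons: "cylinder ((\<zeta>, B) # L) = {y. y \<bullet> \<zeta> \<in> B} \<inter> cylinder L"
  by (auto simp: cylinder_def)

lemma cylinder_append: "cylinder (L @ L') = cylinder L \<inter> cylinder L'"
  by (auto simp: cylinder_def)

lemma cylinder_measurable:
  fixes L :: "('a::{real_inner, second_countable_topology} \<times> real set) list"
  shows "\<forall>(\<zeta>, B)\<in>set L. B \<in> sets borel \<Longrightarrow> cylinder L \<in> sets borel"
proof (induction L)
  case (Cons p L)
  obtain \<zeta> B where p: "p = (\<zeta>, B)" by (cases p)
  then have [measurable]: "B \<in> sets borel" and [measurable]: "cylinder L \<in> sets borel"
    using Cons by auto
  show ?case unfolding p cylinder_Cons by measurable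
qed (simp add: cylinder_Nil)

lemma Int_stable_cylinders: "Int_stable cylinders"
proof (rule Int_stableI)
  fix U V :: "'a::real_inner set" assume "U \<in> cylinders" "V \<in> cylinders"
  then obtain L L' where "U = cylinder L" "V = cylinder L'"
    "\<forall>(\<zeta>, B)\<in>set L. B \<in> sets borel" "\<forall>(\<zeta>, B)\<in>set L'. B \<in> sets borel"
    by (auto simp: cylinders_def)
  then show "U \<inter> V \<in> cylinders"
    unfolding cylinders_def by (auto intro!: exI[of _ "L @ L'"] simp: cylinder_append)
qed

text \<open>The half-space inequality is a closed condition on its normal, so it passes from a dense
  set to the normal \<open>y - c\<close>, where it reads |y - c|^2 \<le> r |y - c|. For countable
  \<open>D\<close> this places closed balls in the sigma-algebra of cylinders.\<close>

lemma cball_eq_Inter_half_spaces: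
  fixes c :: "'a::real_inner"
  assumes D: "closure D = UNIV" and "0 \<le> r"
  shows "cball c r = (\<Inter>d\<in>D. {y. y \<bullet> d \<in> {..c \<bullet> d + r * norm d}})"
proof (intro equalityI subsetI)
  fix y assume "y \<in> cball c r"
  have "(y - c) \<bullet> d \<le> r * norm d" for d
    using \<open>y \<in> cball c r\<close> norm_cauchy_schwarz[of "y - c" d]
    by (intro order_trans[OF norm_cauchy_schwarz] mult_right_mono) (auto simp: dist_norm norm_minus_commute)
  then show "y \<in> (\<Inter>d\<in>D. {y. y \<bullet> d \<in> {..c \<bullet> d + r * norm d}})"
    by (auto simp: inner_diff_left algebra_simps)
next
  fix y assume "y \<in> (\<Inter>d\<in>D. {y. y \<bullet> d \<in> {..c \<bullet> d + r * norm d}})"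
  then have "D \<subseteq> {d. (y - c) \<bullet> d \<le> r * norm d}" by (auto simp: inner_diff_left algebra_simps)
  moreover have "closed {d. (y - c) \<bullet> d \<le> r * norm d}"
    by (intro closed_Collect_le continuous_intros)
  ultimately have "(y - c) \<bullet> (y - c) \<le> r * norm (y - c)"
    using closure_minimal D by blast
  then have "norm (y - c) * norm (y - c) \<le> r * norm (y - c)"
    by (simp add: power2_norm_eq_inner[symmetric] power2_eq_square)
  then have "norm (y - c) \<le> r" using \<open>0 \<le> r\<close>
    by (cases "y = c") auto
  then show "y \<in> cball c r" by (simp add: dist_norm norm_minus_commute)
qed

text \<open>By separability an open set is a countable union of closed balls with rational radii and
  centres in a countable dense set, and closed balls are countable intersections of
  half-spaces.\<close>

lemma sets_borel_eq_sigma_cylinders: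
  "sets borel = sigma_sets UNIV (cylinders :: 'a::{real_inner, second_countable_topology} set set)"
proof
  show "sigma_sets UNIV cylinders \<subseteq> sets (borel :: 'a measure)"
    using sets.sigma_sets_subset[of cylinders "borel :: 'a measure"] cylinder_measurable
    by (auto simp: cylinders_def)
  obtain D :: "'a set" where D: "countable D" "\<And>X. open X \<Longrightarrow> X \<noteq> {} \<Longrightarrow> \<exists>d\<in>D. d \<in> X"
    using countable_dense_setE by blast
  then have "x \<in> closure D" for x
    using D(2)[of "ball x e" for e] by (force simp: closure_approachable dist_commute)
  with D(1) have D: "countable D" "closure D = UNIV" by auto
  interpret S: sigma_algebra UNIV "sigma_sets UNIV (cylinders :: 'a set set)"
    by (rule sigma_algebra_sigma_sets) simp
  have cball: "cball c r \<in> sigma_sets UNIV cylinders" if "0 \<le> r" for c :: 'a and r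
  proof -
    have "{y. y \<bullet> d \<in> {..u}} \<in> cylinders" for d :: 'a and u
      unfolding cylinders_def by (auto intro!: exI[of _ "[(d, {..u})]"] simp: cylinder_def)
    then show ?thesis
      unfolding cball_eq_Inter_half_spaces[OF D(2) that]
      by (intro S.countable_INT'' D(1) sigma_sets.Basic sigma_sets_top)
  qed
  have "U \<in> sigma_sets UNIV cylinders" if "open U" for U :: "'a set"
  proof -
    define I where "I = {(c, q). c \<in> D \<and> q \<in> \<rat> \<and> 0 \<le> q \<and> cball c q \<subseteq> U}"
    have "countable I"
      by (rule countable_subset[of _ "D \<times> \<rat>"]) (auto simp: I_def D countable_rat)
    have "U = (\<Union>(c, q)\<in>I. cball c q)"
    proof (intro equalityI subsetI)
      fix x assume "x \<in> U"
      then obtain e where e: "0 < e" "ball x e \<subseteq> U" using \<open>open U\<close> by (meson open_contains_ball)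
      then obtain q where q: "q \<in> \<rat>" "0 < q" "q < e / 2" using Rats_dense_in_real[of 0 "e / 2"] by auto
      obtain c where c: "c \<in> D" "dist c x < q"
        using D(2) closure_approachable[of x D] q by auto
      have "cball c q \<subseteq> ball x e"
      proof
        fix z assume "z \<in> cball c q"
        then have "dist x z \<le> dist c x + dist c z" "dist c z \<le> q"
          using dist_triangle[of x z c] by (simp_all add: dist_commute)
        then show "z \<in> ball x e" using c q by simp
      qed
      then have "(c, q) \<in> I" using c q e by (auto simp: I_def)
      moreover have "x \<in> cball c q" using c by simp
      ultimately show "x \<in> (\<Union>(c, q)\<in>I. cball c q)" by (intro UN_I[of "(c, q)"]) auto
    qed (auto simp: I_def)
    moreover have "(\<Union>(c, q)\<in>I. cball c q) \<in> sigma_sets UNIV cylinders"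
      using \<open>countable I\<close> cball by (intro S.countable_UN') (auto simp: I_def)
    ultimately show ?thesis by simp
  qed
  then show "sets (borel :: 'a measure) \<subseteq> sigma_sets UNIV cylinders"
    unfolding borel_def by (subst sets_measure_of) (auto intro!: S.sigma_sets_subset)
qed

lemma finite_measure_eqI_char_fun:
  fixes M N :: "'a::{real_inner, second_countable_topology} measure"
  assumes "finite_measure M" "finite_measure N" "sets M = sets borel" "sets N = sets borel"
    and "\<And>\<xi>. char_fun M \<xi> = char_fun N \<xi>"
  shows "M = N"
proof (rule measure_eqI_generator_eq[where A = "\<lambda>_. UNIV"])
  \<comment> \<open>Cylinders are lists so that this can be an induction on the number of
    constraints. The measures vary in it: the first constraint becomes a density, and the shorter
    cylinder is measured by the restricted measures.\<close>
  have "emeasure M (cylinder L) = emeasure N (cylinder L)"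
    if "\<forall>(\<zeta>, B)\<in>set L. B \<in> sets borel" for L
    using assms that
  proof (induction L arbitrary: M N)
    case Nil
    have "complex_of_real (measure M UNIV) = complex_of_real (measure N UNIV)"
      using Nil(5)[of 0] sets_eq_imp_space_eq[OF Nil(3)] sets_eq_imp_space_eq[OF Nil(4)]
      by (simp add: char_fun_def scaleR_conv_of_real)
    then show ?case
      using Nil(1,2) by (simp add: cylinder_Nil finite_measure.emeasure_eq_measure)
  next
    case (Cons p L)
    obtain \<zeta> B where p: "p = (\<zeta>, B)" by (cases p)
    then have B [measurable]: "B \<in> sets borel" and L: "\<forall>(\<zeta>, B)\<in>set L. B \<in> sets borel"
      using Cons.prems(6) by auto
    have [measurable]: "cylinder L \<in> sets borel" by (rule cylinder_measurable[OF L])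
    note [measurable_cong] = Cons.prems(3,4)
    define d where "d K = density K (indicator {y. y \<bullet> \<zeta> \<in> B} :: 'a \<Rightarrow> ennreal)" for K
    have fin: "finite_measure (d K)"
      if "finite_measure K" and [measurable_cong]: "sets K = sets borel" for K
      using that(1) unfolding d_def
      by (intro finite_measureI) (simp add: emeasure_density finite_measure.emeasure_finite)
    have em: "emeasure (d K) (cylinder L) = emeasure K (cylinder (p # L))"
      if [measurable_cong]: "sets K = sets borel" for K
      unfolding d_def p cylinder_Cons
      by (simp add: emeasure_density indicator_inter_arith[symmetric])
    have "emeasure (d M) (cylinder L) = emeasure (d N) (cylinder L)"
    proof (rule Cons.IH[OF _ _ _ _ _ L])
      show "char_fun (d M) \<xi> = char_fun (d N) \<xi>" for \<xi>
        unfolding d_def by (rule char_fun_density_half_space_eqI) (use Cons.prems B in auto)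
    qed (use fin Cons.prems in \<open>auto simp: d_def\<close>)
    then show ?case using em Cons.prems by simp
  qed
  then show "X \<in> cylinders \<Longrightarrow> emeasure M X = emeasure N X" for X
    by (auto simp: cylinders_def)
  show "range (\<lambda>_. UNIV) \<subseteq> cylinders"
    by (auto simp: cylinders_def cylinder_Nil intro!: exI[of _ "[]"])
qed (use assms(3,4) Int_stable_cylinders sets_borel_eq_sigma_cylinders
    finite_measure.emeasure_finite[OF assms(1)] in auto)

section \<open>Signed measures and differentiation of characteristic functions\<close>

lemma cmod_iexp_diff_le: "cmod (iexp u - iexp v) \<le> \<bar>u - v\<bar>"
proof -
  have "iexp u - iexp v = iexp v * (iexp (u - v) - 1)"
    by (simp add: algebra_simps exp_add[symmetric])
  then have "cmod (iexp u - iexp v) = cmod (iexp (u - v) - 1)"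
    by (simp add: norm_mult)
  also have "\<dots> \<le> \<bar>u - v\<bar>" using iexp_approx1[of "u - v" 0] by simp
  finally show ?thesis .
qed

text \<open>\<open>Q\<close> may have infinite mass; subtracting 1 helps because |iexp u - 1| \<le>
  |u|.\<close>

lemma integrable_iexp_diff:
  fixes Z :: "'b \<Rightarrow> 'a::{real_inner, banach, second_countable_topology}"
  assumes [measurable]: "Z \<in> borel_measurable Q" and "integrable Q Z"
  shows "complex_integrable Q (\<lambda>q. iexp (Z q \<bullet> \<xi>) - 1)"
proof (rule Bochner_Integration.integrable_bound)
  show "integrable Q (\<lambda>q. norm (Z q) * norm \<xi>)" using assms(2) by simp
  show "AE q in Q. norm (iexp (Z q \<bullet> \<xi>) - 1) \<le> norm (norm (Z q) * norm \<xi>)"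
    using cmod_iexp_diff_le[of _ 0] Cauchy_Schwarz_ineq2 by (auto intro!: AE_I2 intro: order_trans)
qed measurable

section \<open>Sums of two measures\<close>

definition sum_measure :: "'a measure \<Rightarrow> 'a measure \<Rightarrow> 'a measure" where
  "sum_measure M N = measure_of (space M) (sets M) (\<lambda>A. emeasure M A + emeasure N A)"

lemma sets_sum_measure [simp, measurable_cong]: "sets (sum_measure M N) = sets M"
  by (simp add: sum_measure_def sets.space_closed sets.sigma_sets_eq sets_measure_of)

lemma space_sum_measure [simp]: "space (sum_measure M N) = space M"
  by (simp add: sum_measure_def sets.space_closed space_measure_of)

lemma emeasure_sum_measure:
  assumes "sets M = sets N" "A \<in> sets M"
  shows "emeasure (sum_measure M N) A = emeasure M A + emeasure N A"
proof (rule emeasure_measure_of[OF sum_measure_def])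
  show "countably_additive (sets (sum_measure M N)) (\<lambda>A. emeasure M A + emeasure N A)"
    using assms(1) by (auto intro!: countably_additiveI simp: suminf_add[symmetric] suminf_emeasure)
qed (use assms in \<open>auto simp: positive_def sets.space_closed dest: sets.sets_into_space\<close>)

lemma integrable_sum_measureD:
  fixes f :: "'a \<Rightarrow> 'b::{banach, second_countable_topology}"
  assumes sets: "sets M = sets N" and f: "integrable (sum_measure M N) f"
  shows "integrable M f" "integrable N f"
proof -
  have *: "integrable K f" if s: "sets K = sets (sum_measure M N)" and "K \<le> sum_measure M N" for K
  proof (rule integrableI_bounded)
    show "f \<in> borel_measurable K"
      using borel_measurable_integrable[OF f] s by (simp cong: measurable_cong_sets)
    have "(\<integral>\<^sup>+x. norm (f x) \<partial>K) \<le> (\<integral>\<^sup>+x. norm (f x) \<partial>sum_measure M N)"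
      by (rule nn_integral_mono_measure[OF that])
    also have "\<dots> < \<infinity>" using f by (simp add: integrable_iff_bounded)
    finally show "(\<integral>\<^sup>+x. norm (f x) \<partial>K) < \<infinity>" .
  qed
  show "integrable M f"
    by (rule *) (use sets in \<open>auto simp: le_measure emeasure_sum_measure\<close>)
  show "integrable N f"
    by (rule *) (use sets in \<open>auto simp: le_measure emeasure_sum_measure\<close>)
qed

text \<open>Induction over integrable functions. On indicators the finiteness of both measures
  matters, since \<open>measure\<close> is additive only there; limits are dominated by 2 |f|, which
  is integrable for each summand.\<close>

lemma integral_sum_measure:
  fixes f :: "'a \<Rightarrow> 'b::{banach, second_countable_topology}"
  assumes sets: "sets M = sets N" and f: "integrable (sum_measure M N) f"
  shows "integral\<^sup>L (sum_measure M N) f = integral\<^sup>L M f + integral\<^sup>L N f"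
  using f
proof induction
  case (base A c)
  then have "emeasure M A + emeasure N A < \<infinity>" and "A \<in> sets M" "A \<in> sets N"
    using sets by (simp_all add: emeasure_sum_measure)
  then have "emeasure M A < \<infinity>" "emeasure N A < \<infinity>" by (auto simp: less_top[symmetric])
  then have "measure (sum_measure M N) A = measure M A + measure N A"
    using base sets by (simp add: measure_def emeasure_sum_measure enn2real_plus)
  then show ?case using base sets sets_eq_imp_space_eq[OF sets] \<open>A \<in> sets M\<close> \<open>A \<in> sets N\<close>
      \<open>emeasure M A < \<infinity>\<close> \<open>emeasure N A < \<infinity>\<close>
    by (simp add: scaleR_add_left sets.Int_space_eq2 sets.sets_into_space Int_absorb2)
next
  case (add f g)
  then show ?case
    by (simp add: integrable_sum_measureD[OF sets])
next
  case (lim f s)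
  have *: "(\<lambda>i. integral\<^sup>L K (s i)) \<longlonglongrightarrow> integral\<^sup>L K f"
    if "sets K = sets M" "integrable K f" "\<And>i. integrable K (s i)" for K
    using lim.hyps(2,3) that sets_eq_imp_space_eq[OF that(1)]
    by (intro integral_dominated_convergence[where w = "\<lambda>x. 2 * norm (f x)"])
       (auto intro: AE_I2)
  have "(\<lambda>i. integral\<^sup>L (sum_measure M N) (s i)) \<longlonglongrightarrow> integral\<^sup>L M f + integral\<^sup>L N f"
    unfolding lim.IH
    by (intro tendsto_add *) (use sets integrable_sum_measureD[OF sets] lim in auto)
  moreover have "(\<lambda>i. integral\<^sup>L (sum_measure M N) (s i)) \<longlonglongrightarrow> integral\<^sup>L (sum_measure M N) f"
    by (rule *) (use lim in auto)
  ultimately show ?case using LIMSEQ_unique by blast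
qed

text \<open>Moving the negative parts of the signed measures to the other side reduces this to positive
  measures.\<close>

lemma signed_measure_eqI_char:
  fixes W1 :: "'b \<Rightarrow> 'a::{real_inner, second_countable_topology}" and W2 :: "'c \<Rightarrow> 'a"
  assumes w1: "integrable R1 w1" and w2: "integrable R2 w2"
    and W [measurable]: "W1 \<in> borel_measurable R1" "W2 \<in> borel_measurable R2"
    and char: "\<And>\<xi>. (\<integral>x. w1 x *\<^sub>R iexp (W1 x \<bullet> \<xi>) \<partial>R1) = (\<integral>x. w2 x *\<^sub>R iexp (W2 x \<bullet> \<xi>) \<partial>R2)"
    and [measurable]: "A \<in> sets borel"
  shows "(\<integral>x. w1 x * indicator A (W1 x) \<partial>R1) = (\<integral>x. w2 x * indicator A (W2 x) \<partial>R2)"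
proof -
  note [measurable] = borel_measurable_integrable[OF w1] borel_measurable_integrable[OF w2]
  define m1 where "m1 u = distr (density R1 (\<lambda>x. ennreal (u x))) borel W1" for u
  define m2 where "m2 u = distr (density R2 (\<lambda>x. ennreal (u x))) borel W2" for u
  have fin: "finite_measure (distr (density R (\<lambda>x. ennreal (u x))) borel W)"
    if u: "integrable R u" and [measurable]: "W \<in> borel_measurable R"
    for R :: "'z measure" and u and W :: "'z \<Rightarrow> 'a"
  proof -
    note [measurable] = borel_measurable_integrable[OF u]
    have "(\<integral>\<^sup>+x. ennreal (u x) \<partial>R) \<le> (\<integral>\<^sup>+x. norm (u x) \<partial>R)"
      by (intro nn_integral_mono ennreal_leI) simp
    also have "\<dots> < \<infinity>" using u by (simp add: integrable_iff_bounded)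
    finally show ?thesis
      by (intro finite_measureI) (simp add: emeasure_distr emeasure_density cong: nn_integral_cong)
  qed
  have int: "(\<integral>y. f y \<partial>distr (density R (\<lambda>x. ennreal (u x))) borel W) = (\<integral>x. u x *\<^sub>R f (W x) \<partial>R)"
    if [measurable]: "u \<in> borel_measurable R" "W \<in> borel_measurable R" "f \<in> borel_measurable borel"
      and u: "\<And>x. 0 \<le> u x"
    for R :: "'z measure" and u and W :: "'z \<Rightarrow> 'a" and f :: "'a \<Rightarrow> 'y::{banach, second_countable_topology}"
    by (subst integral_distr, simp, simp, subst integral_density) (auto simp: u)
  have i1: "integrable R1 (\<lambda>x. max 0 (w1 x))" "integrable R1 (\<lambda>x. max 0 (- w1 x))"
    using w1 by (auto intro!: integrable_max)
  have i2: "integrable R2 (\<lambda>x. max 0 (w2 x))" "integrable R2 (\<lambda>x. max 0 (- w2 x))"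
    using w2 by (auto intro!: integrable_max)
  \<comment> \<open>\<open>L\<close> - \<open>K\<close> is the image of \<open>w1\<close> under
    \<open>W1\<close> minus the image of \<open>w2\<close> under \<open>W2\<close>, arranged so that
    \<open>L\<close> and \<open>K\<close> are both positive and finite.\<close>
  define L where "L = sum_measure (m1 (\<lambda>x. max 0 (w1 x))) (m2 (\<lambda>x. max 0 (- w2 x)))"
  define K where "K = sum_measure (m2 (\<lambda>x. max 0 (w2 x))) (m1 (\<lambda>x. max 0 (- w1 x)))"
  note fins = fin[OF i1(1) W(1), folded m1_def] fin[OF i1(2) W(1), folded m1_def]
    fin[OF i2(1) W(2), folded m2_def] fin[OF i2(2) W(2), folded m2_def]
  have finL: "finite_measure L"
    using fins by (intro finite_measureI)
      (simp add: L_def emeasure_sum_measure m1_def m2_def finite_measure.emeasure_finite)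
  have finK: "finite_measure K"
    using fins by (intro finite_measureI)
      (simp add: K_def emeasure_sum_measure m1_def m2_def finite_measure.emeasure_finite)
  have sL [measurable_cong]: "sets L = sets borel" and sK [measurable_cong]: "sets K = sets borel"
    by (simp_all add: L_def K_def m1_def m2_def)
  have part: "integrable R (\<lambda>x. u x *\<^sub>R f (W x))"
    if u: "integrable R u" and [measurable]: "W \<in> borel_measurable R" "f \<in> borel_measurable borel"
      and b: "\<And>y. norm (f y) \<le> 1"
    for R :: "'z measure" and u and W :: "'z \<Rightarrow> 'a" and f :: "'a \<Rightarrow> 'y::{banach, second_countable_topology}"
  proof (rule Bochner_Integration.integrable_bound[OF u])
    show "(\<lambda>x. u x *\<^sub>R f (W x)) \<in> borel_measurable R"
      using borel_measurable_integrable[OF u] by measurable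
    show "AE x in R. norm (u x *\<^sub>R f (W x)) \<le> norm (u x)"
      using b by (intro AE_I2) (simp add: mult_left_le)
  qed
  have pos_neg: "(\<integral>x. max 0 (u x) *\<^sub>R f (W x) \<partial>R) - (\<integral>x. max 0 (- u x) *\<^sub>R f (W x) \<partial>R) =
      (\<integral>x. u x *\<^sub>R f (W x) \<partial>R)"
    if "integrable R (\<lambda>x. max 0 (u x))" "integrable R (\<lambda>x. max 0 (- u x))"
      and "W \<in> borel_measurable R" "f \<in> borel_measurable borel" "\<And>y. norm (f y) \<le> 1"
    for R :: "'z measure" and u and W :: "'z \<Rightarrow> 'a" and f :: "'a \<Rightarrow> 'y::{banach, second_countable_topology}"
    using part[OF that(1,3-5)] part[OF that(2,3-5)]
    by (subst Bochner_Integration.integral_diff[symmetric])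
       (auto intro!: Bochner_Integration.integral_cong simp: max_def simp flip: scaleR_diff_left)
  have bdd: "integrable L f" "integrable K f"
    if [measurable]: "f \<in> borel_measurable borel" and b: "\<And>y. norm (f y) \<le> 1"
    for f :: "'a \<Rightarrow> 'y::{banach, second_countable_topology}"
    using b by (auto intro!: finite_measure.integrable_const_bound[OF finL, where B = 1]
      finite_measure.integrable_const_bound[OF finK, where B = 1])
  have intL: "(\<integral>y. f y \<partial>L) = (\<integral>x. max 0 (w1 x) *\<^sub>R f (W1 x) \<partial>R1) + (\<integral>x. max 0 (- w2 x) *\<^sub>R f (W2 x) \<partial>R2)"
    if [measurable]: "f \<in> borel_measurable borel" and b: "\<And>y. norm (f y) \<le> 1"
    for f :: "'a \<Rightarrow> 'y::{banach, second_countable_topology}"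
  proof -
    have "(\<integral>y. f y \<partial>L) = (\<integral>y. f y \<partial>m1 (\<lambda>x. max 0 (w1 x))) + (\<integral>y. f y \<partial>m2 (\<lambda>x. max 0 (- w2 x)))"
      using bdd(1)[OF that] unfolding L_def
      by (intro integral_sum_measure) (simp_all add: m1_def m2_def)
    moreover have "(\<integral>y. f y \<partial>m1 (\<lambda>x. max 0 (w1 x))) = (\<integral>x. max 0 (w1 x) *\<^sub>R f (W1 x) \<partial>R1)"
      unfolding m1_def by (rule int) auto
    moreover have "(\<integral>y. f y \<partial>m2 (\<lambda>x. max 0 (- w2 x))) = (\<integral>x. max 0 (- w2 x) *\<^sub>R f (W2 x) \<partial>R2)"
      unfolding m2_def by (rule int) auto
    ultimately show ?thesis by simp
  qed
  have intK: "(\<integral>y. f y \<partial>K) = (\<integral>x. max 0 (w2 x) *\<^sub>R f (W2 x) \<partial>R2) + (\<integral>x. max 0 (- w1 x) *\<^sub>R f (W1 x) \<partial>R1)"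
    if [measurable]: "f \<in> borel_measurable borel" and b: "\<And>y. norm (f y) \<le> 1"
    for f :: "'a \<Rightarrow> 'y::{banach, second_countable_topology}"
  proof -
    have "(\<integral>y. f y \<partial>K) = (\<integral>y. f y \<partial>m2 (\<lambda>x. max 0 (w2 x))) + (\<integral>y. f y \<partial>m1 (\<lambda>x. max 0 (- w1 x)))"
      using bdd(2)[OF that] unfolding K_def
      by (intro integral_sum_measure) (simp_all add: m1_def m2_def)
    moreover have "(\<integral>y. f y \<partial>m2 (\<lambda>x. max 0 (w2 x))) = (\<integral>x. max 0 (w2 x) *\<^sub>R f (W2 x) \<partial>R2)"
      unfolding m2_def by (rule int) auto
    moreover have "(\<integral>y. f y \<partial>m1 (\<lambda>x. max 0 (- w1 x))) = (\<integral>x. max 0 (- w1 x) *\<^sub>R f (W1 x) \<partial>R1)"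
      unfolding m1_def by (rule int) auto
    ultimately show ?thesis by simp
  qed
  \<comment> \<open>This equation is used in two ways: with complex exponentials it yields
    \<open>L = K\<close>, and then with the indicator of \<open>A\<close> it yields the
    claim.\<close>
  have diff: "(\<integral>y. f y \<partial>L) - (\<integral>y. f y \<partial>K) = (\<integral>x. w1 x *\<^sub>R f (W1 x) \<partial>R1) - (\<integral>x. w2 x *\<^sub>R f (W2 x) \<partial>R2)"
    if "f \<in> borel_measurable borel" "\<And>y. norm (f y) \<le> 1"
    for f :: "'a \<Rightarrow> 'y::{banach, second_countable_topology}"
    using intL[OF that] intK[OF that] pos_neg[OF i1 W(1) that] pos_neg[OF i2 W(2) that] by (simp add: algebra_simps)
  have "L = K"
  proof (rule finite_measure_eqI_char_fun[OF finL finK sL sK])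
    show "char_fun L \<xi> = char_fun K \<xi>" for \<xi>
      using diff[of "\<lambda>y. iexp (y \<bullet> \<xi>)"] char[of \<xi>] unfolding char_fun_def by simp
  qed
  then show ?thesis using diff[of "\<lambda>y. indicator A y :: real"] by (simp add: indicator_def)
qed

section \<open>Differentiation under the integral sign\<close>

lemma has_vector_derivative_iff_quotient:
  "(f has_vector_derivative D) (at x) \<longleftrightarrow> ((\<lambda>t. (f t - f x) /\<^sub>R (t - x)) \<longlongrightarrow> D) (at x)"
proof -
  have "norm (f t - f x - (t - x) *\<^sub>R D) / norm (t - x) = norm ((f t - f x) /\<^sub>R (t - x) - D)"
    if "t \<noteq> x" for t
  proof -
    have "(f t - f x) /\<^sub>R (t - x) - D = (f t - f x - (t - x) *\<^sub>R D) /\<^sub>R (t - x)"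
      using that by (simp add: scaleR_diff_right)
    then show ?thesis by (simp add: divide_inverse mult.commute)
  qed
  then have "((\<lambda>t. norm (f t - f x - (t - x) *\<^sub>R D) / norm (t - x)) \<longlongrightarrow> 0) (at x) \<longleftrightarrow>
      ((\<lambda>t. norm ((f t - f x) /\<^sub>R (t - x) - D)) \<longlongrightarrow> 0) (at x)"
    by (intro tendsto_cong) (simp add: eventually_at_filter)
  then show ?thesis
    unfolding has_vector_derivative_def has_derivative_iff_norm
    by (simp add: tendsto_norm_zero_iff LIM_zero_iff bounded_linear_scaleR_left)
qed

text \<open>Since iexp is 1-Lipschitz, |Z| |\<eta>| dominates all difference quotients, so dominated
  convergence applies along every sequence tending to 0. The same lemma serves for the jumps and,
  with the identity as \<open>Z\<close>, for the law itself.\<close>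

lemma iexp_integral_has_vector_derivative:
  fixes Z :: "'b \<Rightarrow> 'a::{real_inner, banach, second_countable_topology}"
  assumes Z: "integrable Q Z"
  shows "((\<lambda>t::real. \<integral>q. iexp (Z q \<bullet> (\<xi> + t *\<^sub>R \<eta>)) - 1 \<partial>Q) has_vector_derivative
    (\<integral>q. \<i> * complex_of_real (Z q \<bullet> \<eta>) * iexp (Z q \<bullet> \<xi>) \<partial>Q)) (at 0)"
proof -
  note [measurable] = borel_measurable_integrable[OF Z]
  let ?F = "\<lambda>t. \<integral>q. iexp (Z q \<bullet> (\<xi> + t *\<^sub>R \<eta>)) - 1 \<partial>Q"
  let ?D = "\<integral>q. \<i> * complex_of_real (Z q \<bullet> \<eta>) * iexp (Z q \<bullet> \<xi>) \<partial>Q"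
  note int = integrable_iexp_diff[OF borel_measurable_integrable[OF Z] Z]
  have "((\<lambda>t. (?F t - ?F 0) /\<^sub>R t) \<longlongrightarrow> ?D) (at 0)"
    unfolding tendsto_at_iff_sequentially o_def
  proof (intro allI impI)
    fix X :: "nat \<Rightarrow> real" assume X: "\<forall>i. X i \<in> UNIV - {0}" "X \<longlonglongrightarrow> 0"
    have "(\<lambda>i. \<integral>q. (iexp (Z q \<bullet> (\<xi> + X i *\<^sub>R \<eta>)) - iexp (Z q \<bullet> \<xi>)) /\<^sub>R X i \<partial>Q) \<longlonglongrightarrow> ?D"
    proof (rule integral_dominated_convergence[where w = "\<lambda>q. norm (Z q) * norm \<eta>"])
      show "integrable Q (\<lambda>q. norm (Z q) * norm \<eta>)" using Z by simp
      show "AE q in Q. (\<lambda>i. (iexp (Z q \<bullet> (\<xi> + X i *\<^sub>R \<eta>)) - iexp (Z q \<bullet> \<xi>)) /\<^sub>R X i) \<longlonglongrightarrow>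
          \<i> * complex_of_real (Z q \<bullet> \<eta>) * iexp (Z q \<bullet> \<xi>)"
      proof (rule AE_I2)
        fix q
        have "((\<lambda>t. \<i> * complex_of_real (Z q \<bullet> \<xi> + t * (Z q \<bullet> \<eta>))) has_vector_derivative
            \<i> * complex_of_real (Z q \<bullet> \<eta>)) (at 0)"
          by (intro has_vector_derivative_mult_right has_vector_derivative_of_real)
             (auto intro!: derivative_eq_intros)
        from field_vector_diff_chain_at[OF this DERIV_exp]
        have "((\<lambda>t. iexp (Z q \<bullet> (\<xi> + t *\<^sub>R \<eta>))) has_vector_derivative
            \<i> * complex_of_real (Z q \<bullet> \<eta>) * iexp (Z q \<bullet> \<xi>)) (at 0)"
          by (simp add: o_def inner_add_right)
        then have "((\<lambda>t. (iexp (Z q \<bullet> (\<xi> + t *\<^sub>R \<eta>)) - iexp (Z q \<bullet> \<xi>)) /\<^sub>R t) \<longlongrightarrow>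
            \<i> * complex_of_real (Z q \<bullet> \<eta>) * iexp (Z q \<bullet> \<xi>)) (at 0)"
          by (simp add: has_vector_derivative_iff_quotient)
        then show "(\<lambda>i. (iexp (Z q \<bullet> (\<xi> + X i *\<^sub>R \<eta>)) - iexp (Z q \<bullet> \<xi>)) /\<^sub>R X i) \<longlonglongrightarrow>
          \<i> * complex_of_real (Z q \<bullet> \<eta>) * iexp (Z q \<bullet> \<xi>)"
          using X unfolding tendsto_at_iff_sequentially o_def by blast
      qed
      fix i
      show "AE q in Q. norm ((iexp (Z q \<bullet> (\<xi> + X i *\<^sub>R \<eta>)) - iexp (Z q \<bullet> \<xi>)) /\<^sub>R X i)
          \<le> norm (Z q) * norm \<eta>"
      proof (rule AE_I2)
        fix q
        have "cmod (iexp (Z q \<bullet> (\<xi> + X i *\<^sub>R \<eta>)) - iexp (Z q \<bullet> \<xi>)) \<le> \<bar>X i\<bar> * (norm (Z q) * norm \<eta>)"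
          using cmod_iexp_diff_le[of "Z q \<bullet> (\<xi> + X i *\<^sub>R \<eta>)" "Z q \<bullet> \<xi>"]
            mult_left_mono[OF Cauchy_Schwarz_ineq2[of "Z q" \<eta>], of "\<bar>X i\<bar>"]
          by (simp add: inner_add_right abs_mult)
        moreover have "0 < \<bar>X i\<bar>" using X(1) by simp
        moreover have "norm (v /\<^sub>R X i) = norm v / \<bar>X i\<bar>" for v :: complex
          by (simp add: divide_inverse mult.commute)
        ultimately show "norm ((iexp (Z q \<bullet> (\<xi> + X i *\<^sub>R \<eta>)) - iexp (Z q \<bullet> \<xi>)) /\<^sub>R X i)
            \<le> norm (Z q) * norm \<eta>"
          by (simp only: pos_divide_le_eq mult.commute)
      qed
    qed measurable
    moreover have "(\<integral>q. (iexp (Z q \<bullet> (\<xi> + X i *\<^sub>R \<eta>)) - iexp (Z q \<bullet> \<xi>)) /\<^sub>R X i \<partial>Q) =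
        (?F (X i) - ?F 0) /\<^sub>R X i" for i
      using int[of "\<xi> + X i *\<^sub>R \<eta>"] int[of \<xi>]
      by (simp flip: Bochner_Integration.integral_diff)
    ultimately show "(\<lambda>i. (?F (X i) - ?F 0) /\<^sub>R X i) \<longlonglongrightarrow> ?D" by (simp only:)
  qed
  then show ?thesis by (simp add: has_vector_derivative_iff_quotient)
qed

section \<open>Moments of a law with summable jumps\<close>

text \<open>\<open>\<sigma>\<close> has the characteristic function of \<open>a\<close> plus the sum
  of \<open>Z\<close> over a Poisson process with intensity \<open>Q\<close>, without compensation.
  Jumps are a function on a parameter space because their image measure may have infinite mass at 0;
  points with \<open>Z\<close> = 0 contribute nothing to the integrals below.\<close>

locale jump_law = law: prob_space \<sigma> + jumps: sigma_finite_measure Q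
  for \<sigma> :: "'a::{real_inner, banach, second_countable_topology} measure" and Q :: "'b measure" +
  fixes Z :: "'b \<Rightarrow> 'a" and a :: 'a
  assumes sets_law [measurable_cong]: "sets \<sigma> = sets borel"
    and integrable_law: "integrable \<sigma> (\<lambda>y. y)"
    and integrable_jumps: "integrable Q Z"
    and char_fun_law: "char_fun \<sigma> \<xi> =
      exp (\<i> * complex_of_real (a \<bullet> \<xi>) + (\<integral>q. iexp (Z q \<bullet> \<xi>) - 1 \<partial>Q))"
begin

sublocale pair_sigma_finite Q \<sigma> ..

lemma measurable_jumps [measurable]: "Z \<in> borel_measurable Q"
  using integrable_jumps by simp

lemma integrable_iexp_law: "complex_integrable \<sigma> (\<lambda>y. iexp (y \<bullet> \<xi>))"
  by (rule integrable_iexp_inner[OF law.finite_measure_axioms sets_law])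

text \<open>Differentiate \<open>char_fun\<close> at \<open>\<xi>\<close> in direction
  \<open>\<eta>\<close> twice over, once as an integral against \<open>\<sigma>\<close> and once
  through the exponential formula, and cancel the factor \<open>\<i>\<close>.\<close>

lemma char_fun_derivative:
  "(\<integral>y. (y \<bullet> \<eta>) *\<^sub>R iexp (y \<bullet> \<xi>) \<partial>\<sigma>) =
    (complex_of_real (a \<bullet> \<eta>) + (\<integral>q. (Z q \<bullet> \<eta>) *\<^sub>R iexp (Z q \<bullet> \<xi>) \<partial>Q)) * char_fun \<sigma> \<xi>"
proof -
  define D where "D = (\<integral>y. (y \<bullet> \<eta>) *\<^sub>R iexp (y \<bullet> \<xi>) \<partial>\<sigma>)"
  define E where "E = (\<integral>q. (Z q \<bullet> \<eta>) *\<^sub>R iexp (Z q \<bullet> \<xi>) \<partial>Q)"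
  have *: "(\<integral>q. \<i> * complex_of_real (W q \<bullet> \<eta>) * iexp (W q \<bullet> \<xi>) \<partial>R) =
      \<i> * (\<integral>q. (W q \<bullet> \<eta>) *\<^sub>R iexp (W q \<bullet> \<xi>) \<partial>R)" for R :: "'z measure" and W :: "'z \<Rightarrow> 'a"
    by (simp only: integral_mult_right_zero[symmetric] scaleR_conv_of_real mult.assoc)
  \<comment> \<open>Brings the law into the form with 1 subtracted, so that the differentiation
    lemma for jumps covers it too.\<close>
  have "char_fun \<sigma> \<zeta> = (\<integral>y. iexp (y \<bullet> \<zeta>) - 1 \<partial>\<sigma>) + 1" for \<zeta>
    using integrable_iexp_law[of \<zeta>]
    by (subst Bochner_Integration.integral_diff) (auto simp: char_fun_def law.prob_space)
  then have "((\<lambda>t. char_fun \<sigma> (\<xi> + t *\<^sub>R \<eta>)) has_vector_derivative \<i> * D + 0) (at 0)"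
    using iexp_integral_has_vector_derivative[OF integrable_law, of \<xi> \<eta>]
    by (simp only: * D_def) (intro has_vector_derivative_add has_vector_derivative_const)
  moreover have "((\<lambda>t. \<i> * complex_of_real (a \<bullet> \<xi> + t * (a \<bullet> \<eta>)) +
      (\<integral>q. iexp (Z q \<bullet> (\<xi> + t *\<^sub>R \<eta>)) - 1 \<partial>Q)) has_vector_derivative
      \<i> * complex_of_real (a \<bullet> \<eta>) + \<i> * E) (at 0)"
    using iexp_integral_has_vector_derivative[OF integrable_jumps, of \<xi> \<eta>]
    unfolding * E_def
    by (intro has_vector_derivative_add has_vector_derivative_mult_right has_vector_derivative_of_real)
       (auto intro!: derivative_eq_intros)
  from field_vector_diff_chain_at[OF this DERIV_exp]
  have "((\<lambda>t. char_fun \<sigma> (\<xi> + t *\<^sub>R \<eta>)) has_vector_derivative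
      (\<i> * complex_of_real (a \<bullet> \<eta>) + \<i> * E) * char_fun \<sigma> \<xi>) (at 0)"
    unfolding char_fun_law by (simp add: o_def inner_add_right)
  ultimately have "\<i> * D + 0 = (\<i> * complex_of_real (a \<bullet> \<eta>) + \<i> * E) * char_fun \<sigma> \<xi>"
    by (rule vector_derivative_unique_at)
  then have "\<i> * D = \<i> * ((complex_of_real (a \<bullet> \<eta>) + E) * char_fun \<sigma> \<xi>)"
    by (simp add: algebra_simps)
  then show ?thesis unfolding D_def E_def by simp
qed

lemma integrable_jumps_pair: "integrable (Q \<Otimes>\<^sub>M \<sigma>) (\<lambda>p. Z (fst p))"
  using integrable_jumps
  by (intro Fubini_integrable) (auto simp: law.prob_space)

text \<open>The two sides are signed measures with the same Fourier transform: by Fubini, the jump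
  integral times \<open>char_fun \<sigma> \<xi>\<close> in \<open>char_fun_derivative\<close> is the
  transform of \<open>Z + y\<close> weighted by \<open>Z \<bullet> \<eta>\<close>.\<close>

lemma stein_indicator:
  assumes A: "A \<in> sets borel"
  shows "(\<integral>y. ((y - a) \<bullet> \<eta>) * indicator A y \<partial>\<sigma>) =
    (\<integral>p. (Z (fst p) \<bullet> \<eta>) * indicator A (Z (fst p) + snd p) \<partial>(Q \<Otimes>\<^sub>M \<sigma>))"
proof (rule signed_measure_eqI_char[OF _ _ _ _ _ A])
  show int: "integrable \<sigma> (\<lambda>y. (y - a) \<bullet> \<eta>)"
    using integrable_law by simp
  show int2: "integrable (Q \<Otimes>\<^sub>M \<sigma>) (\<lambda>p. Z (fst p) \<bullet> \<eta>)"
    using integrable_jumps_pair by simp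
  show "(\<integral>y. ((y - a) \<bullet> \<eta>) *\<^sub>R iexp (y \<bullet> \<xi>) \<partial>\<sigma>) =
    (\<integral>p. (Z (fst p) \<bullet> \<eta>) *\<^sub>R iexp ((Z (fst p) + snd p) \<bullet> \<xi>) \<partial>(Q \<Otimes>\<^sub>M \<sigma>))" for \<xi>
  proof -
    have "integrable \<sigma> (\<lambda>y. y \<bullet> \<eta>)" using integrable_law by simp
    then have "integrable \<sigma> (\<lambda>y. (y \<bullet> \<eta>) *\<^sub>R iexp (y \<bullet> \<xi>))"
      by (rule Bochner_Integration.integrable_bound) simp_all
    then have "(\<integral>y. ((y - a) \<bullet> \<eta>) *\<^sub>R iexp (y \<bullet> \<xi>) \<partial>\<sigma>) =
        (\<integral>y. (y \<bullet> \<eta>) *\<^sub>R iexp (y \<bullet> \<xi>) \<partial>\<sigma>) - (a \<bullet> \<eta>) *\<^sub>R char_fun \<sigma> \<xi>"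
      using integrable_iexp_law[of \<xi>] unfolding inner_diff_left scaleR_diff_left char_fun_def
      by (subst Bochner_Integration.integral_diff) auto
    also have "\<dots> = (\<integral>q. (Z q \<bullet> \<eta>) *\<^sub>R iexp (Z q \<bullet> \<xi>) \<partial>Q) * char_fun \<sigma> \<xi>"
      unfolding char_fun_derivative by (simp add: scaleR_conv_of_real algebra_simps)
    also have "\<dots> = (\<integral>q. \<integral>y. (Z q \<bullet> \<eta>) *\<^sub>R iexp ((Z q + y) \<bullet> \<xi>) \<partial>\<sigma> \<partial>Q)"
    proof -
      have "(Z q \<bullet> \<eta>) *\<^sub>R iexp ((Z q + y) \<bullet> \<xi>) = (Z q \<bullet> \<eta>) *\<^sub>R iexp (Z q \<bullet> \<xi>) * iexp (y \<bullet> \<xi>)" for q y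
        by (simp add: inner_add_left exp_add algebra_simps)
      then show ?thesis
        by (simp only: integral_mult_right_zero integral_mult_left_zero flip: char_fun_def)
    qed
    also have "\<dots> = (\<integral>p. (Z (fst p) \<bullet> \<eta>) *\<^sub>R iexp ((Z (fst p) + snd p) \<bullet> \<xi>) \<partial>(Q \<Otimes>\<^sub>M \<sigma>))"
    proof -
      have "integrable (Q \<Otimes>\<^sub>M \<sigma>) (\<lambda>p. (Z (fst p) \<bullet> \<eta>) *\<^sub>R iexp ((Z (fst p) + snd p) \<bullet> \<xi>))"
        by (rule Bochner_Integration.integrable_bound[OF int2]) simp_all
      from integral_fst'[OF this] show ?thesis by simp
    qed
    finally show ?thesis .
  qed
qed measurable

text \<open>Stein's identity: the size-biased law of \<open>\<sigma>\<close> in each direction is obtained by adding an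
  independent jump.\<close>

lemma stein:
  assumes [measurable]: "f \<in> borel_measurable borel" and f: "\<And>y. norm (f y) \<le> C"
  shows "(\<integral>y. (y - a) \<bullet> f y \<partial>\<sigma>) =
    (\<integral>p. Z (fst p) \<bullet> f (Z (fst p) + snd p) \<partial>(Q \<Otimes>\<^sub>M \<sigma>))"
proof -
  note [measurable] = borel_measurable_integrable[OF integrable_jumps_pair]
  have int_law: "integrable \<sigma> (\<lambda>y. (y - a) \<bullet> g y)"
    if [measurable]: "g \<in> borel_measurable borel" and g: "\<And>y. norm (g y) \<le> K" for g :: "'a \<Rightarrow> 'a" and K
  proof (rule Bochner_Integration.integrable_bound)
    show "integrable \<sigma> (\<lambda>y. norm (y - a) * K)" using integrable_law by simp
    have "0 \<le> K" using g[of 0] norm_ge_zero order_trans by blast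
    then show "AE y in \<sigma>. norm ((y - a) \<bullet> g y) \<le> norm (norm (y - a) * K)"
      using g by (intro AE_I2) (auto intro!: order_trans[OF Cauchy_Schwarz_ineq2] mult_left_mono)
  qed measurable
  have int_pair: "integrable (Q \<Otimes>\<^sub>M \<sigma>) (\<lambda>p. Z (fst p) \<bullet> g (Z (fst p) + snd p))"
    if [measurable]: "g \<in> borel_measurable borel" and g: "\<And>y. norm (g y) \<le> K" for g :: "'a \<Rightarrow> 'a" and K
  proof (rule Bochner_Integration.integrable_bound)
    show "integrable (Q \<Otimes>\<^sub>M \<sigma>) (\<lambda>p. norm (Z (fst p)) * K)"
      using integrable_jumps_pair by simp
    have "0 \<le> K" using g[of 0] norm_ge_zero order_trans by blast
    then show "AE p in Q \<Otimes>\<^sub>M \<sigma>. norm (Z (fst p) \<bullet> g (Z (fst p) + snd p)) \<le> norm (norm (Z (fst p)) * K)"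
      using g by (intro AE_I2) (auto intro!: order_trans[OF Cauchy_Schwarz_ineq2] mult_left_mono)
  qed measurable
  \<comment> \<open>A simple field is a finite sum of indicators times fixed vectors
    \<open>v\<close>, and each \<open>v\<close> serves as the direction
    \<open>\<eta>\<close>.\<close>
  have simple: "(\<integral>y. (y - a) \<bullet> g y \<partial>\<sigma>) = (\<integral>p. Z (fst p) \<bullet> g (Z (fst p) + snd p) \<partial>(Q \<Otimes>\<^sub>M \<sigma>))"
    if g: "simple_function borel g" for g :: "'a \<Rightarrow> 'a"
  proof -
    have rep: "g y = (\<Sum>v\<in>range g. indicator (g -` {v}) y *\<^sub>R v)" for y
      using simple_function_indicator_representation_banach[OF g, of y]
      by (simp only: space_borel Int_UNIV_right UNIV_I simp_thms)
    have fin: "finite (range g)" and A: "\<And>v. g -` {v} \<in> sets borel"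
      using g simple_functionD[OF g] by auto
    have rep_inner: "x \<bullet> g y = (\<Sum>v\<in>range g. (x \<bullet> v) * indicator (g -` {v}) y)" for x y
      by (subst rep) (simp add: inner_sum_right mult.commute)
    have m: "(\<lambda>y. indicator (g -` {v}) y *\<^sub>R v) \<in> borel_measurable borel" for v
      by (intro borel_measurable_scaleR borel_measurable_indicator A) simp
    have n: "norm (indicator (g -` {v}) y *\<^sub>R v) \<le> norm v" for v y by (simp add: indicator_def)
    have i1: "integrable \<sigma> (\<lambda>y. ((y - a) \<bullet> v) * indicator (g -` {v}) y)" for v
      using int_law[OF m n] by (simp only: inner_scaleR_right mult.commute)
    have i2: "integrable (Q \<Otimes>\<^sub>M \<sigma>) (\<lambda>p. (Z (fst p) \<bullet> v) * indicator (g -` {v}) (Z (fst p) + snd p))" for v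
      using int_pair[OF m n] by (simp only: inner_scaleR_right mult.commute)
    show ?thesis
      unfolding rep_inner using i1 i2 stein_indicator[OF A]
      by (simp add: Bochner_Integration.integral_sum)
  qed
  \<comment> \<open>The approximating simple fields satisfy |F| \<le> 2 |f|, whence the factor 2 in
    the dominating functions.\<close>
  obtain F where F: "\<And>i. simple_function borel (F i)" "\<And>y. (\<lambda>i. F i y) \<longlonglongrightarrow> f y"
      "\<And>i y. dist (F i y) 0 \<le> 2 * dist (f y) 0"
    using borel_measurable_implies_sequence_metric[of f borel 0] by auto
  have F_meas [measurable]: "F i \<in> borel_measurable borel" for i
    using F(1) by (rule borel_measurable_simple_function)
  have F_le: "norm (F i y) \<le> 2 * C" for i y using F(3)[of i y] f[of y] by simp
  have "0 \<le> C" using f[of 0] norm_ge_zero order_trans by blast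
  have "(\<lambda>i. \<integral>y. (y - a) \<bullet> F i y \<partial>\<sigma>) \<longlonglongrightarrow> (\<integral>y. (y - a) \<bullet> f y \<partial>\<sigma>)"
  proof (rule integral_dominated_convergence[where w = "\<lambda>y. norm (y - a) * (2 * C)"])
    show "integrable \<sigma> (\<lambda>y. norm (y - a) * (2 * C))" using integrable_law by simp
    show "AE y in \<sigma>. norm ((y - a) \<bullet> F i y) \<le> norm (y - a) * (2 * C)" for i
      using F_le by (intro AE_I2) (auto intro!: order_trans[OF Cauchy_Schwarz_ineq2] mult_left_mono)
    show "AE y in \<sigma>. (\<lambda>i. (y - a) \<bullet> F i y) \<longlonglongrightarrow> (y - a) \<bullet> f y"
      by (intro AE_I2 tendsto_intros F)
  qed measurable
  moreover have "(\<lambda>i. \<integral>p. Z (fst p) \<bullet> F i (Z (fst p) + snd p) \<partial>(Q \<Otimes>\<^sub>M \<sigma>)) \<longlonglongrightarrow>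
      (\<integral>p. Z (fst p) \<bullet> f (Z (fst p) + snd p) \<partial>(Q \<Otimes>\<^sub>M \<sigma>))"
  proof (rule integral_dominated_convergence[where w = "\<lambda>p. norm (Z (fst p)) * (2 * C)"])
    show "integrable (Q \<Otimes>\<^sub>M \<sigma>) (\<lambda>p. norm (Z (fst p)) * (2 * C))"
      using integrable_jumps_pair by simp
    show "AE p in Q \<Otimes>\<^sub>M \<sigma>. norm (Z (fst p) \<bullet> F i (Z (fst p) + snd p)) \<le> norm (Z (fst p)) * (2 * C)" for i
      using F_le by (intro AE_I2) (auto intro!: order_trans[OF Cauchy_Schwarz_ineq2] mult_left_mono)
    show "AE p in Q \<Otimes>\<^sub>M \<sigma>. (\<lambda>i. Z (fst p) \<bullet> F i (Z (fst p) + snd p)) \<longlonglongrightarrow>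
        Z (fst p) \<bullet> f (Z (fst p) + snd p)"
      by (intro AE_I2 tendsto_intros F)
  qed measurable
  ultimately show ?thesis unfolding simple[OF F(1)] by (rule LIMSEQ_unique)
qed

text \<open>\<open>stein\<close> needs a bounded field and the p-th moment is not yet known to be
  finite, hence the truncation. The right-hand side of the identity is bounded independently of the
  radius, so monotone convergence finishes.\<close>

lemma moment_step:
  assumes "1 \<le> p" and Zp: "(\<integral>\<^sup>+q. ennreal (norm (Z q) powr p) \<partial>Q) < \<infinity>"
    and law_p: "(\<integral>\<^sup>+y. ennreal (norm y powr (p - 1)) \<partial>\<sigma>) < \<infinity>"
  shows "(\<integral>\<^sup>+y. ennreal (norm y powr p) \<partial>\<sigma>) < \<infinity>"
proof -
  define G where "G r = norm (Z (fst r)) * norm (Z (fst r) + snd r) powr (p - 1)" for r :: "'b \<times> 'a"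
  have [measurable]: "G \<in> borel_measurable (Q \<Otimes>\<^sub>M \<sigma>)" unfolding G_def by measurable
  have G_le: "ennreal (G (q, y)) \<le> ennreal (2 powr (p - 1)) *
      (ennreal (norm (Z q) powr p) + ennreal (norm (Z q)) * ennreal (norm y powr (p - 1)))" for q y
  proof -
    \<comment> \<open>Comparing with twice the maximum works for every exponent p - 1 \<ge> 0,
      including those below 1 where the power is not convex.\<close>
    have "norm (Z q + y) powr (p - 1) \<le> (2 * max (norm (Z q)) (norm y)) powr (p - 1)"
      using assms(1) norm_triangle_ineq[of "Z q" y] by (intro powr_mono2) auto
    also have "\<dots> = 2 powr (p - 1) * max (norm (Z q)) (norm y) powr (p - 1)"
      by (simp add: powr_mult)
    also have "max (norm (Z q)) (norm y) powr (p - 1) \<le> norm (Z q) powr (p - 1) + norm y powr (p - 1)"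
      by (simp add: max_def)
    finally have "G (q, y) \<le> norm (Z q) * (2 powr (p - 1) * (norm (Z q) powr (p - 1) + norm y powr (p - 1)))"
      unfolding G_def by (simp add: mult_left_mono)
    also have "norm (Z q) * norm (Z q) powr (p - 1) = norm (Z q) powr p"
      by (simp add: powr_mult_base)
    then have "norm (Z q) * (2 powr (p - 1) * (norm (Z q) powr (p - 1) + norm y powr (p - 1))) =
        2 powr (p - 1) * (norm (Z q) powr p + norm (Z q) * norm y powr (p - 1))"
      by (simp add: algebra_simps)
    finally have "ennreal (G (q, y)) \<le>
        ennreal (2 powr (p - 1) * (norm (Z q) powr p + norm (Z q) * norm y powr (p - 1)))"
      by (rule ennreal_leI)
    then show ?thesis by (simp add: ennreal_mult ennreal_plus)
  qed
  have int_G: "integrable (Q \<Otimes>\<^sub>M \<sigma>) G"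
  proof (rule integrableI_nonneg)
    have "(\<integral>\<^sup>+r. ennreal (G r) \<partial>(Q \<Otimes>\<^sub>M \<sigma>)) = (\<integral>\<^sup>+q. \<integral>\<^sup>+y. ennreal (G (q, y)) \<partial>\<sigma> \<partial>Q)"
      by (rule law.nn_integral_fst[symmetric]) measurable
    also have "\<dots> \<le> (\<integral>\<^sup>+q. \<integral>\<^sup>+y. ennreal (2 powr (p - 1)) *
        (ennreal (norm (Z q) powr p) + ennreal (norm (Z q)) * ennreal (norm y powr (p - 1))) \<partial>\<sigma> \<partial>Q)"
      by (intro nn_integral_mono G_le)
    also have "\<dots> = ennreal (2 powr (p - 1)) * ((\<integral>\<^sup>+q. ennreal (norm (Z q) powr p) \<partial>Q) +
        (\<integral>\<^sup>+q. ennreal (norm (Z q)) \<partial>Q) * (\<integral>\<^sup>+y. ennreal (norm y powr (p - 1)) \<partial>\<sigma>))"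
      by (simp add: nn_integral_cmult nn_integral_add nn_integral_multc law.emeasure_space_1)
    also have "\<dots> < \<infinity>"
      using Zp law_p integrable_jumps
      by (simp add: ennreal_mult_less_top integrable_iff_bounded)
    finally show "(\<integral>\<^sup>+r. ennreal (G r) \<partial>(Q \<Otimes>\<^sub>M \<sigma>)) < \<infinity>" .
  qed (auto simp: G_def)
  have int_p: "integrable \<sigma> (\<lambda>y. norm y powr (p - 1))"
    using law_p by (intro integrableI_nonneg) auto
  have [measurable]: "cball (0 :: 'a) (real n) \<in> sets borel" for n by simp
  define B where "B = norm a * (\<integral>y. norm y powr (p - 1) \<partial>\<sigma>) + (\<integral>r. G r \<partial>(Q \<Otimes>\<^sub>M \<sigma>))"
  have trunc: "(\<integral>\<^sup>+y. ennreal (indicator (cball 0 (real n)) y * norm y powr p) \<partial>\<sigma>) \<le> ennreal B" for n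
  proof -
    \<comment> \<open>For p < 2 the exponent is negative, but \<open>f 0 = 0\<close>; away from 0
      the length is |y|^(p-1) and the inner product with y is |y|^p inside the ball.\<close>
    define f where "f y = (indicator (cball 0 (real n)) y * norm y powr (p - 2)) *\<^sub>R y" for y :: 'a
    have [measurable]: "f \<in> borel_measurable borel" unfolding f_def by measurable
    have norm_f: "norm (f y) = indicator (cball 0 (real n)) y * norm y powr (p - 1)" for y
      by (cases "y = 0") (auto simp: f_def powr_mult_base mult.commute indicator_def)
    have f_le: "norm (f y) \<le> norm y powr (p - 1)" for y unfolding norm_f by (simp add: indicator_def)
    have f_bdd: "norm (f y) \<le> real n powr (p - 1)" for y
      using assms(1) unfolding norm_f by (auto simp: indicator_def intro: powr_mono2)
    have inner_f: "y \<bullet> f y = indicator (cball 0 (real n)) y * norm y powr p" for y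
    proof -
      have "y \<bullet> f y = indicator (cball 0 (real n)) y * (norm y powr (p - 2) * (norm y)\<^sup>2)"
        by (simp add: f_def power2_norm_eq_inner)
      also have "norm y powr (p - 2) * (norm y)\<^sup>2 = norm y powr p"
        by (cases "y = 0") (simp_all add: powr_add[symmetric] flip: powr_numeral)
      finally show ?thesis .
    qed
    have int_f: "integrable \<sigma> (\<lambda>y. y \<bullet> f y)"
    proof (rule law.integrable_const_bound)
      show "AE y in \<sigma>. norm (y \<bullet> f y) \<le> real n powr p"
        using assms(1) unfolding inner_f by (auto simp: indicator_def intro!: powr_mono2 AE_I2)
    qed measurable
    have int_af: "integrable \<sigma> (\<lambda>y. a \<bullet> f y)"
      by (rule law.integrable_const_bound[where B = "norm a * real n powr (p - 1)"])
         (auto intro!: AE_I2 order_trans[OF Cauchy_Schwarz_ineq2] mult_left_mono f_bdd)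
    have "(\<integral>y. y \<bullet> f y \<partial>\<sigma>) = (\<integral>y. a \<bullet> f y \<partial>\<sigma>) + (\<integral>y. (y - a) \<bullet> f y \<partial>\<sigma>)"
      using int_f int_af by (simp add: inner_diff_left)
    also have "(\<integral>y. (y - a) \<bullet> f y \<partial>\<sigma>) = (\<integral>r. Z (fst r) \<bullet> f (Z (fst r) + snd r) \<partial>(Q \<Otimes>\<^sub>M \<sigma>))"
      by (rule stein[OF _ f_bdd]) measurable
    also have "\<dots> \<le> (\<integral>r. G r \<partial>(Q \<Otimes>\<^sub>M \<sigma>))"
    proof (rule integral_mono'[OF int_G])
      show "Z (fst r) \<bullet> f (Z (fst r) + snd r) \<le> G r" for r
        unfolding G_def by (intro order_trans[OF norm_cauchy_schwarz] mult_left_mono f_le) auto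
    qed (simp add: G_def)
    also have "(\<integral>y. a \<bullet> f y \<partial>\<sigma>) \<le> (\<integral>y. norm a * norm y powr (p - 1) \<partial>\<sigma>)"
    proof (rule integral_mono'[OF integrable_mult_right[OF int_p]])
      show "a \<bullet> f y \<le> norm a * norm y powr (p - 1)" for y
        by (intro order_trans[OF norm_cauchy_schwarz] mult_left_mono f_le) auto
    qed auto
    finally have "(\<integral>y. y \<bullet> f y \<partial>\<sigma>) \<le> B" unfolding B_def by simp
    moreover have "(\<integral>\<^sup>+y. ennreal (y \<bullet> f y) \<partial>\<sigma>) = ennreal (\<integral>y. y \<bullet> f y \<partial>\<sigma>)"
      by (rule nn_integral_eq_integral[OF int_f]) (simp add: inner_f)
    ultimately show ?thesis unfolding inner_f by (simp add: ennreal_leI)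
  qed
  have "(\<lambda>n. \<integral>\<^sup>+y. ennreal (indicator (cball 0 (real n)) y * norm y powr p) \<partial>\<sigma>) \<longlonglongrightarrow>
      (\<integral>\<^sup>+y. ennreal (norm y powr p) \<partial>\<sigma>)"
  proof (rule nn_integral_LIMSEQ)
    show "incseq (\<lambda>n y. ennreal (indicator (cball (0 :: 'a) (real n)) y * norm y powr p))"
      by (auto simp: incseq_def le_fun_def indicator_def intro!: ennreal_leI)
    show "(\<lambda>n. ennreal (indicator (cball 0 (real n)) y * norm y powr p)) \<longlonglongrightarrow> ennreal (norm y powr p)"
      for y :: 'a
    proof (rule tendsto_eventually)
      obtain N where "norm y \<le> real N" using real_arch_simple by blast
      then show "\<forall>\<^sub>F n in sequentially.
          ennreal (indicator (cball 0 (real n)) y * norm y powr p) = ennreal (norm y powr p)"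
        by (intro eventually_sequentiallyI[of N]) (auto simp: indicator_def)
    qed
  qed measurable
  then have "(\<integral>\<^sup>+y. ennreal (norm y powr p) \<partial>\<sigma>) \<le> ennreal B"
    by (rule LIMSEQ_le_const2) (use trunc in blast)
  then show ?thesis using ennreal_less_top le_less_trans by (metis infinity_ennreal_def)
qed

text \<open>Induction on the number of unit steps down to p = 1, where integrability of the law is
  the base case.\<close>

lemma moment_finite:
  assumes "1 \<le> p" and "(\<integral>\<^sup>+q. ennreal (norm (Z q) powr p) \<partial>Q) < \<infinity>"
  shows "(\<integral>\<^sup>+y. ennreal (norm y powr p) \<partial>\<sigma>) < \<infinity>"
proof -
  have "(\<integral>\<^sup>+y. ennreal (norm y powr p) \<partial>\<sigma>) < \<infinity>"
    if "1 \<le> p" "p \<le> real n + 1" "(\<integral>\<^sup>+q. ennreal (norm (Z q) powr p) \<partial>Q) < \<infinity>" for n p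
    using that
  proof (induction n arbitrary: p)
    case 0
    then have "p = 1" by simp
    then show ?case using integrable_law by (simp add: integrable_iff_bounded)
  next
    case (Suc n)
    show ?case
    proof (rule moment_step[OF Suc.prems(1,3)])
      show "(\<integral>\<^sup>+y. ennreal (norm y powr (p - 1)) \<partial>\<sigma>) < \<infinity>"
      \<comment> \<open>An exponent in [0,1] is controlled by the first moment,
        \<open>\<sigma>\<close> being a probability measure; above 1 the induction hypothesis takes
        over.\<close>
      proof (cases "p - 1 \<le> 1")
        case True
        have "ennreal (norm y powr (p - 1)) \<le> 1 + ennreal (norm y)" for y :: 'a
        proof -
          have "norm y powr (p - 1) \<le> 1 + norm y"
          proof (cases "norm y \<le> 1")
            case True
            then have "norm y powr (p - 1) \<le> 1 powr (p - 1)"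
              using Suc.prems(1) by (intro powr_mono2) auto
            then show ?thesis using norm_ge_zero[of y] unfolding powr_one_eq_one by linarith
          next
            case False
            then have "norm y powr (p - 1) \<le> norm y powr 1"
              using \<open>p - 1 \<le> 1\<close> by (intro powr_mono) auto
            then show ?thesis by simp
          qed
          then show ?thesis by (metis ennreal_leI ennreal_plus ennreal_1 norm_ge_zero zero_le_one)
        qed
        then have "(\<integral>\<^sup>+y. ennreal (norm y powr (p - 1)) \<partial>\<sigma>) \<le> (\<integral>\<^sup>+y. 1 + ennreal (norm y) \<partial>\<sigma>)"
          by (intro nn_integral_mono)
        also have "\<dots> < \<infinity>"
          using integrable_law by (simp add: nn_integral_add law.emeasure_space_1 integrable_iff_bounded)
        finally show ?thesis .
      next
        case False
        show ?thesis
        proof (rule Suc.IH)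
          \<comment> \<open>Constants need not be integrable over \<open>Q\<close>, so |Z|^(p-1) is
            interpolated between |Z| and |Z|^p, using 1 < p - 1 < p.\<close>
          have "ennreal (norm (Z q) powr (p - 1)) \<le> ennreal (norm (Z q)) + ennreal (norm (Z q) powr p)" for q
          proof -
            have "norm (Z q) powr (p - 1) \<le> norm (Z q) + norm (Z q) powr p"
            proof (cases "norm (Z q) \<le> 1")
              case True
              then have "norm (Z q) powr (p - 1) \<le> norm (Z q) powr 1"
                using False by (intro powr_mono') auto
              then show ?thesis by (simp add: add_increasing2)
            next
              case False
              then have "norm (Z q) powr (p - 1) \<le> norm (Z q) powr p"
                by (intro powr_mono) auto
              then show ?thesis by (simp add: add_increasing)
            qed
            then show ?thesis by (simp flip: ennreal_plus)
          qed
          then have "(\<integral>\<^sup>+q. ennreal (norm (Z q) powr (p - 1)) \<partial>Q) \<le>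
              (\<integral>\<^sup>+q. ennreal (norm (Z q)) + ennreal (norm (Z q) powr p) \<partial>Q)"
            by (intro nn_integral_mono)
          also have "\<dots> < \<infinity>"
            using integrable_jumps Suc.prems(3) by (simp add: nn_integral_add integrable_iff_bounded)
          finally show "(\<integral>\<^sup>+q. ennreal (norm (Z q) powr (p - 1)) \<partial>Q) < \<infinity>" .
        qed (use False Suc.prems in auto)
      qed
    qed
  qed
  moreover obtain n where "p \<le> real n" using real_arch_simple by blast
  ultimately show ?thesis using assms by (metis add_increasing2 zero_le_one)
qed

end

section \<open>Orbits of the jumps under the semigroup\<close>

text \<open>By Markov's inequality the sets where min 1 |x|^2 is at least 1/(n+1) have finite mass;
  with the null set {0} they cover the space. This makes Fubini available.\<close>

lemma levy_measure_sigma_finite: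
  fixes M :: "'a::{real_normed_vector, second_countable_topology} measure"
  assumes "levy_measure M"
  shows "sigma_finite_measure M"
proof
  have sets [measurable_cong]: "sets M = sets borel" and null: "emeasure M {0} = 0"
    and fin: "(\<integral>\<^sup>+x. ennreal (min 1 ((norm x)\<^sup>2)) \<partial>M) < \<infinity>"
    using assms by (auto simp: levy_measure_def)
  have sp: "space M = UNIV" using sets_eq_imp_space_eq[OF sets] by simp
  let ?A = "\<lambda>n. {x \<in> space M. 1 \<le> ennreal (real (Suc n)) * ennreal (min 1 ((norm x)\<^sup>2))}"
  have A_fin: "emeasure M (?A n) \<noteq> \<infinity>" for n
  proof -
    have "emeasure M (?A n) \<le> ennreal (real (Suc n)) *
        (\<integral>\<^sup>+x. ennreal (min 1 ((norm x)\<^sup>2)) * indicator (space M) x \<partial>M)"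
      by (rule nn_integral_Markov_inequality) measurable
    also have "\<dots> < \<infinity>" using fin by (simp add: sp ennreal_mult_less_top)
    finally show ?thesis by simp
  qed
  have cover: "\<Union> (insert {0} (range ?A)) = space M"
  proof -
    have "x \<in> \<Union> (range ?A)" if "x \<noteq> 0" for x
    proof -
      define m where "m = min 1 ((norm x)\<^sup>2)"
      have "0 < m" using that by (simp add: m_def)
      then obtain n where "1 / m < real n" using reals_Archimedean2 by blast
      then have "1 \<le> real (Suc n) * m" using \<open>0 < m\<close> by (simp add: field_simps)
      then have "ennreal 1 \<le> ennreal (real (Suc n) * m)" by (rule ennreal_leI)
      then have "1 \<le> ennreal (real (Suc n)) * ennreal m"
        using \<open>0 < m\<close> by (simp add: ennreal_mult del: of_nat_Suc)
      then show ?thesis by (auto simp: sp m_def)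
    qed
    then show ?thesis by (auto simp: sp)
  qed
  have "?A n \<in> sets M" for n by measurable
  moreover have "{0} \<in> sets M" by (simp add: sets)
  ultimately have "insert {0} (range ?A) \<subseteq> sets M" by blast
  then show "\<exists>A. countable A \<and> A \<subseteq> sets M \<and> \<Union> A = space M \<and> (\<forall>a\<in>A. emeasure M a \<noteq> \<infinity>)"
    using A_fin cover null
    by (intro exI[of _ "insert {0} (range ?A)"] conjI ballI) (auto simp del: of_nat_Suc)
qed

lemma c0_semigroup_right_continuous:
  assumes T: "c0_semigroup T" and "0 \<le> s"
  shows "((\<lambda>t. T t x) \<longlongrightarrow> T s x) (at_right s)"
proof -
  have "((\<lambda>t. T t (T s x)) \<longlongrightarrow> T s x) (at_right 0)" using T by (simp add: c0_semigroup_def)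
  moreover have "\<forall>\<^sub>F t in at_right 0. T t (T s x) = T (t + s) x"
    using c0_semigroup_add[OF T _ assms(2)] by (auto simp: eventually_at_filter)
  ultimately have "((\<lambda>t. T (t + s) x) \<longlongrightarrow> T s x) (at_right 0)"
    by (rule Lim_transform_eventually)
  then show ?thesis by (subst filterlim_at_right_to_0)
qed

text \<open>Extending by 0 to negative times allows time to be integrated over the whole line:
  \<open>T\<close> is arbitrary there, whereas zero jumps add nothing.\<close>

definition orbit :: "(real \<Rightarrow> 'a::real_normed_vector \<Rightarrow> 'a) \<Rightarrow> real \<times> 'a \<Rightarrow> 'a" where
  "orbit T p = (if 0 \<le> fst p then T (fst p) (snd p) else 0)"

text \<open>Right continuity in time lets one round time up to a grid of countably many values.\<close>

lemma borel_measurable_orbit: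
  fixes T :: "real \<Rightarrow> 'a::{real_normed_vector, second_countable_topology} \<Rightarrow> 'a"
  assumes T: "c0_semigroup T"
  shows "orbit T \<in> borel_measurable (borel \<Otimes>\<^sub>M borel)"
proof (rule borel_measurable_LIMSEQ_metric)
  \<comment> \<open>Floor plus one, so that the grid point lies strictly to the right of
    \<open>s\<close> and right continuity applies.\<close>
  define r where "r n s = real_of_int (\<lfloor>real (Suc n) * s\<rfloor> + 1) / real (Suc n)" for n s
  define F where "F n p = (if 0 \<le> fst p then T (r n (fst p)) (snd p) else 0)" for n and p :: "real \<times> 'a"
  have r: "s < r n s" "r n s \<le> s + 1 / real (Suc n)" for n s
  proof -
    have "real (Suc n) * s < real_of_int (\<lfloor>real (Suc n) * s\<rfloor> + 1)" by linarith
    then show "s < r n s" unfolding r_def by (simp add: field_simps)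
    have "real_of_int (\<lfloor>real (Suc n) * s\<rfloor> + 1) \<le> real (Suc n) * s + 1" by linarith
    then have "r n s \<le> (real (Suc n) * s + 1) / real (Suc n)"
      unfolding r_def by (rule divide_right_mono) simp
    then show "r n s \<le> s + 1 / real (Suc n)" by (simp add: add_divide_distrib del: of_nat_Suc)
  qed
  show "F n \<in> borel_measurable (borel \<Otimes>\<^sub>M borel)" for n
  proof -
    \<comment> \<open>\<open>F n\<close> on the k-th grid cell, where the rounded time is constant;
      the guard avoids negative times, at which \<open>T\<close> need not be measurable.\<close>
    define g where "g k p = (if 0 \<le> real_of_int (k + 1) / real (Suc n)
        then T (real_of_int (k + 1) / real (Suc n)) (snd p) else 0)" for k :: int and p :: "real \<times> 'a"
    have "g k \<in> borel_measurable (borel \<Otimes>\<^sub>M borel)" for k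
    proof (cases "0 \<le> real_of_int (k + 1) / real (Suc n)")
      case True
      then have "continuous_on UNIV (T (real_of_int (k + 1) / real (Suc n)))"
        by (intro linear_continuous_on c0_semigroup_bounded_linear[OF T])
      then have "T (real_of_int (k + 1) / real (Suc n)) \<in> borel_measurable borel"
        by (rule borel_measurable_continuous_onI)
      then have "(\<lambda>p. T (real_of_int (k + 1) / real (Suc n)) (snd p)) \<in> borel_measurable (borel \<Otimes>\<^sub>M borel)"
        by measurable
      then show ?thesis unfolding g_def using True by simp
    next
      case False
      then show ?thesis unfolding g_def by simp
    qed
    then have "(\<lambda>p. g \<lfloor>real (Suc n) * fst p\<rfloor> p) \<in> borel_measurable (borel \<Otimes>\<^sub>M borel)"
      by (rule measurable_compose_countable) measurable
    then have "(\<lambda>p. if 0 \<le> fst p then g \<lfloor>real (Suc n) * fst p\<rfloor> p else 0) \<in>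
        borel_measurable (borel \<Otimes>\<^sub>M borel)"
      by measurable
    also have "(\<lambda>p. if 0 \<le> fst p then g \<lfloor>real (Suc n) * fst p\<rfloor> p else 0) = F n"
      using r(1) order.strict_trans1[OF _ r(1)] unfolding F_def g_def
      by (auto simp: fun_eq_iff r_def[symmetric] less_imp_le simp del: of_int_add of_nat_Suc)
    finally show ?thesis .
  qed
  show "(\<lambda>n. F n p) \<longlonglongrightarrow> orbit T p" for p
  proof (cases "0 \<le> fst p")
    case True
    have "(\<lambda>n. r n (fst p)) \<longlonglongrightarrow> fst p"
    proof (rule tendsto_sandwich[where f = "\<lambda>_. fst p" and h = "\<lambda>n. fst p + 1 / real (Suc n)"])
      have "(\<lambda>n. fst p + 1 / real (Suc n)) \<longlonglongrightarrow> fst p + 0"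
        by (intro tendsto_intros LIMSEQ_Suc[OF lim_1_over_n])
      then show "(\<lambda>n. fst p + 1 / real (Suc n)) \<longlonglongrightarrow> fst p" by simp
      show "\<forall>\<^sub>F n in sequentially. fst p \<le> r n (fst p)"
        by (intro always_eventually allI less_imp_le r)
      show "\<forall>\<^sub>F n in sequentially. r n (fst p) \<le> fst p + 1 / real (Suc n)"
        by (intro always_eventually allI r)
    qed (rule tendsto_const)
    moreover have "\<forall>\<^sub>F n in sequentially. r n (fst p) \<in> {fst p<..} \<and> r n (fst p) \<noteq> fst p"
      using r(1) by (intro always_eventually allI) (simp add: less_imp_neq[symmetric])
    ultimately have "filterlim (\<lambda>n. r n (fst p)) (at_right (fst p)) sequentially"
      unfolding filterlim_at by blast
    from filterlim_compose[OF c0_semigroup_right_continuous[OF T True] this]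
    show ?thesis using True by (simp add: F_def orbit_def)
  next
    case False
    then show ?thesis by (simp add: F_def orbit_def)
  qed
qed

section \<open>The invariant measure\<close>

locale mehler_jumps = jumps: sigma_finite_measure M
  for M :: "'a::{real_inner, banach, second_countable_topology} measure" +
  fixes T :: "real \<Rightarrow> 'a \<Rightarrow> 'a" and b :: 'a and \<mu> :: "real \<Rightarrow> 'a measure" and h :: "real \<Rightarrow> real"
  assumes T: "c0_semigroup T"
    and sets_M [measurable_cong]: "sets M = sets borel"
    and mu: "mehler_measures T b M \<mu>"
    and moment_M_1: "moment M 1 < \<infinity>"
    and h: "set_integrable lebesgue {0<..} h"
    and dom: "\<And>t. 0 < t \<Longrightarrow> dominates_image (h t) M (T t)"
begin

abbreviation Q :: "(real \<times> 'a) measure" where "Q \<equiv> lborel \<Otimes>\<^sub>M M"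

sublocale pair_sigma_finite lborel M ..

lemma orbit_measurable [measurable]: "orbit T \<in> borel_measurable Q"
  using borel_measurable_orbit[OF T] by (simp cong: measurable_cong_sets)

lemma borel_measurable_T:
  assumes "0 \<le> s"
  shows "T s \<in> borel_measurable borel"
  using c0_semigroup_bounded_linear[OF T assms]
  by (intro borel_measurable_continuous_onI linear_continuous_on)

lemma orbit_eq: "0 \<le> s \<Longrightarrow> orbit T (s, x) = T s x"
  by (simp add: orbit_def)

lemma moment_orbit_finite:
  assumes p: "0 \<le> p" "moment M p < \<infinity>"
  shows "(\<integral>\<^sup>+q. ennreal (norm (orbit T q) powr p) \<partial>Q) < \<infinity>"
proof -
  have *: "(\<integral>\<^sup>+x. ennreal (norm (orbit T (s, x)) powr p) \<partial>M) \<le> ennreal (h s) * moment M p"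
    if "0 < s" for s
  proof -
    have [measurable]: "T s \<in> borel_measurable M"
      using borel_measurable_T[of s] that by (simp cong: measurable_cong_sets add: sets_M)
    have "distr M borel (T s) \<le> scale_measure (ennreal (h s)) M"
      using dom[OF that] by (subst le_measure) (auto simp: dominates_image_def sets_M)
    then have "(\<integral>\<^sup>+z. ennreal (norm z powr p) \<partial>distr M borel (T s)) \<le>
        (\<integral>\<^sup>+z. ennreal (norm z powr p) \<partial>scale_measure (ennreal (h s)) M)"
      by (intro nn_integral_mono_measure) (simp add: sets_M)
    then show ?thesis
      using that by (simp add: nn_integral_distr nn_integral_scale_measure moment_def orbit_eq)
  qed
  have neg: "(\<integral>\<^sup>+x. ennreal (norm (orbit T (s, x)) powr p) \<partial>M) = 0" if "s < 0" for s
    using that by (simp add: orbit_def)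
  have "(\<integral>\<^sup>+q. ennreal (norm (orbit T q) powr p) \<partial>Q) =
      (\<integral>\<^sup>+s. \<integral>\<^sup>+x. ennreal (norm (orbit T (s, x)) powr p) \<partial>M \<partial>lborel)"
    by (rule jumps.nn_integral_fst[symmetric]) measurable
  \<comment> \<open>The norm is taken because the locale records no sign for
    \<open>h\<close>.\<close>
  also have "\<dots> \<le> (\<integral>\<^sup>+s. ennreal (norm (indicator {0<..} s *\<^sub>R h s)) * moment M p \<partial>lborel)"
  proof (rule nn_integral_mono_AE)
    show "AE s in lborel. (\<integral>\<^sup>+x. ennreal (norm (orbit T (s, x)) powr p) \<partial>M) \<le>
        ennreal (norm (indicator {0<..} s *\<^sub>R h s)) * moment M p"
      \<comment> \<open>Domination is available only at strictly positive times; time 0 is a null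
        set.\<close>
      using AE_lborel_singleton[of 0]
    proof eventually_elim
      case (elim s)
      show ?case
      proof (cases "0 < s")
        case True
        have "ennreal (h s) * moment M p \<le> ennreal (norm (h s)) * moment M p"
          by (intro mult_right_mono ennreal_leI) auto
        then show ?thesis using order_trans[OF *[OF True]] True by simp
      next
        case False
        then show ?thesis using neg elim by simp
      qed
    qed
  qed
  \<comment> \<open>\<open>h\<close> is only Lebesgue measurable, so its integral is handled in the
    completion.\<close>
  also have "\<dots> = (\<integral>\<^sup>+s. ennreal (norm (indicator {0<..} s *\<^sub>R h s)) * moment M p \<partial>lebesgue)"
    by (simp add: nn_integral_completion)
  also have "\<dots> = (\<integral>\<^sup>+s. ennreal (norm (indicator {0<..} s *\<^sub>R h s)) \<partial>lebesgue) * moment M p"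
    using h unfolding set_integrable_def by (intro nn_integral_multc) auto
  also have "\<dots> < \<infinity>"
    using h p unfolding set_integrable_def by (simp add: integrable_iff_bounded ennreal_mult_less_top)
  finally show ?thesis .
qed

lemma integrable_orbit: "integrable Q (orbit T)"
  using moment_orbit_finite[OF _ moment_M_1] by (simp add: integrable_iff_bounded)

lemma integrable_M: "integrable M (\<lambda>x. x)"
  using moment_M_1 by (simp add: integrable_iff_bounded moment_def)

lemma integrable_T: "0 \<le> s \<Longrightarrow> integrable M (T s)"
  using integrable_bounded_linear[OF c0_semigroup_bounded_linear[OF T] integrable_M] by simp

text \<open>Local boundedness of the semigroup enters here, to bound the orbit on the compact time
  interval.\<close>

lemma set_integrable_T: "set_integrable lborel {0..t} (\<lambda>s. T s c)"
proof -
  obtain K where K: "\<And>s x. 0 \<le> s \<Longrightarrow> s \<le> t \<Longrightarrow> norm (T s x) \<le> K * norm x"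
    using c0_semigroup_locally_bounded[OF T] by metis
  have "(\<lambda>s. orbit T (s, c)) \<in> borel_measurable borel"
    using borel_measurable_orbit[OF T] by measurable
  then have "(\<lambda>s. indicator {0..t} s *\<^sub>R orbit T (s, c)) \<in> borel_measurable borel"
    by measurable
  also have "(\<lambda>s. indicator {0..t} s *\<^sub>R orbit T (s, c)) = (\<lambda>s. indicator {0..t} s *\<^sub>R T s c)"
    by (auto simp: fun_eq_iff orbit_def indicator_def)
  finally have [measurable]: "(\<lambda>s. indicator {0..t} s *\<^sub>R T s c) \<in> borel_measurable borel" .
  show ?thesis unfolding set_integrable_def
  proof (rule Bochner_Integration.integrable_bound)
    show "integrable lborel (\<lambda>s. indicator {0..t} s * (K * norm c))"
      by (intro integrable_mult_left integrable_real_indicator) (auto simp: emeasure_lborel_Icc_eq)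
    show "AE s in lborel. norm (indicator {0..t} s *\<^sub>R T s c) \<le> norm (indicator {0..t} s * (K * norm c))"
      using K[of _ c] by (intro AE_I2) (auto simp: indicator_def intro: order_trans[OF _ abs_ge_self])
  qed measurable
qed

text \<open>The drift of the same Levy exponent written without compensation, as the finite first
  moment of \<open>M\<close> permits.\<close>

definition pure_drift :: 'a where
  "pure_drift = b - (\<integral>x. indicator (ball 0 1) x *\<^sub>R x \<partial>M)"

lemma integrable_small: "integrable M (\<lambda>x. indicator (ball 0 1) x *\<^sub>R x)"
  using integrable_M by (rule integrable_mult_indicator[rotated]) (simp add: sets_M)

definition jump_exponent :: "'a \<Rightarrow> real \<Rightarrow> complex" where
  "jump_exponent \<xi> s = (\<integral>x. iexp (orbit T (s, x) \<bullet> \<xi>) - 1 \<partial>M)"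

text \<open>The cutoff sees x and not \<open>T s x\<close>, so after the adjoint is moved across,
  the compensator is \<open>T s\<close> applied to a fixed vector and merges with
  \<open>T s b\<close>.\<close>

lemma levy_symbol_adjoint:
  assumes s: "0 \<le> s"
  shows "levy_symbol b M (adjoint (T s) \<xi>) =
    - (\<i> * complex_of_real (T s pure_drift \<bullet> \<xi>) + jump_exponent \<xi> s)"
proof -
  interpret T: bounded_linear "T s" by (rule c0_semigroup_bounded_linear[OF T s])
  have adj: "x \<bullet> adjoint (T s) \<xi> = T s x \<bullet> \<xi>" for x
    by (rule adjoint_inner[OF T.bounded_linear_axioms])
  define c where "c = (\<integral>x. indicator (ball 0 1) x *\<^sub>R x \<partial>M)"
  have [measurable]: "T s \<in> borel_measurable M"
    using borel_measurable_integrable[OF integrable_T[OF s]] .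
  have i1: "complex_integrable M (\<lambda>x. iexp (T s x \<bullet> \<xi>) - 1)"
    by (rule integrable_iexp_diff[OF _ integrable_T[OF s]]) measurable
  have eq: "T s (indicator (ball 0 1) x *\<^sub>R x) \<bullet> \<xi> = (T s x \<bullet> \<xi>) * indicator (ball 0 1) x" for x
    by (simp add: T.scaleR)
  have i2: "integrable M (\<lambda>x. (T s x \<bullet> \<xi>) * indicator (ball 0 1) x)"
    using integrable_inner_left[OF integrable_bounded_linear[OF T.bounded_linear_axioms integrable_small], of \<xi>]
    unfolding eq by simp
  have "T s c \<bullet> \<xi> = (\<integral>x. (T s x \<bullet> \<xi>) * indicator (ball 0 1) x \<partial>M)"
    unfolding c_def eq[symmetric]
    using integrable_bounded_linear[OF T.bounded_linear_axioms integrable_small]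
    by (simp add: integral_bounded_linear[OF T.bounded_linear_axioms integrable_small, symmetric])
  then have "levy_symbol b M (adjoint (T s) \<xi>) =
      - \<i> * complex_of_real (T s b \<bullet> \<xi>) - ((\<integral>x. iexp (T s x \<bullet> \<xi>) - 1 \<partial>M) - \<i> * complex_of_real (T s c \<bullet> \<xi>))"
    using i1 i2 unfolding levy_symbol_def adj inner_commute[of "adjoint (T s) \<xi>" b]
    by (subst Bochner_Integration.integral_diff) (auto simp del: of_real_mult)
  moreover have "jump_exponent \<xi> s = (\<integral>x. iexp (T s x \<bullet> \<xi>) - 1 \<partial>M)"
    using s by (simp add: jump_exponent_def orbit_eq)
  moreover have "complex_of_real (T s pure_drift \<bullet> \<xi>) =
      complex_of_real (T s b \<bullet> \<xi>) - complex_of_real (T s c \<bullet> \<xi>)"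
    by (simp add: pure_drift_def c_def T.diff inner_diff_left)
  ultimately show ?thesis by (simp only: right_diff_distrib) simp
qed

lemma integrable_jump_exponent: "integrable lborel (jump_exponent \<xi>)"
  and integral_jump_exponent: "(\<integral>s. jump_exponent \<xi> s \<partial>lborel) = (\<integral>q. iexp (orbit T q \<bullet> \<xi>) - 1 \<partial>Q)"
proof -
  note int = integrable_iexp_diff[OF orbit_measurable integrable_orbit, of \<xi>]
  show "integrable lborel (jump_exponent \<xi>)"
    using integrable_fst'[OF int] by (simp add: jump_exponent_def[abs_def])
  show "(\<integral>s. jump_exponent \<xi> s \<partial>lborel) = (\<integral>q. iexp (orbit T q \<bullet> \<xi>) - 1 \<partial>Q)"
    using integral_fst'[OF int] by (simp add: jump_exponent_def)
qed

lemma tendsto_set_integral_Icc: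
  fixes f :: "real \<Rightarrow> 'z::{banach, second_countable_topology}"
  assumes "integrable lborel f" and zero: "\<And>s. s < 0 \<Longrightarrow> f s = 0"
  shows "((\<lambda>t. LINT s:{0..t}|lborel. f s) \<longlongrightarrow> (\<integral>s. f s \<partial>lborel)) at_top"
  unfolding set_lebesgue_integral_def
proof (rule integral_dominated_convergence_at_top)
  show "integrable lborel (\<lambda>s. norm (f s))" using assms(1) by simp
  note [measurable] = borel_measurable_integrable[OF assms(1)]
  show "f \<in> borel_measurable lborel" by measurable
  show "(\<lambda>s. indicator {0..t} s *\<^sub>R f s) \<in> borel_measurable lborel" for t by measurable
  show "\<forall>\<^sub>F t in at_top. AE s in lborel. norm (indicator {0..t} s *\<^sub>R f s) \<le> norm (f s)"
    by (intro always_eventually allI AE_I2) (simp add: indicator_def)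
  show "AE s in lborel. ((\<lambda>t. indicator {0..t} s *\<^sub>R f s) \<longlongrightarrow> f s) at_top"
  proof (intro AE_I2 tendsto_eventually)
    show "\<forall>\<^sub>F t in at_top. indicator {0..t} s *\<^sub>R f s = f s" for s
      using eventually_ge_at_top[of s] by eventually_elim (use zero[of s] in \<open>auto simp: indicator_def not_le\<close>)
  qed
qed

text \<open>The drift up to time t is the integral of \<open>T s pure_drift\<close> plus that of
  \<open>G s\<close>, the mean of \<open>T s x\<close> over the jumps with \<open>T s x\<close> in
  the unit ball. \<open>G\<close> is integrable over all times, so the limit is \<open>b_inf\<close>
  minus its total integral.\<close>

lemma pure_drift_tendsto:
  assumes "(drift T b M \<longlongrightarrow> b_inf) at_top"
  obtains a where "((\<lambda>t. LINT s:{0..t}|lborel. T s pure_drift) \<longlongrightarrow> a) at_top"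
proof -
  define G where "G s = (\<integral>x. indicator (ball 0 1) (orbit T (s, x)) *\<^sub>R orbit T (s, x) \<partial>M)" for s
  have "integrable Q (\<lambda>q. indicator (ball 0 1) (orbit T q) *\<^sub>R orbit T q)"
    by (rule Bochner_Integration.integrable_bound[OF integrable_orbit])
       (auto simp: indicator_def)
  then have G: "integrable lborel G" unfolding G_def by (rule integrable_fst')
  have G_neg: "G s = 0" if "s < 0" for s using that by (simp add: G_def orbit_def)
  define c where "c = (\<integral>x. indicator (ball 0 1) x *\<^sub>R x \<partial>M)"
  have inner: "(\<integral>x. (indicator (ball 0 1) (T s x) - indicator (ball 0 1) x :: real) *\<^sub>R T s x \<partial>M) =
      G s - T s c" if s: "0 \<le> s" for s
  proof -
    interpret T: bounded_linear "T s" by (rule c0_semigroup_bounded_linear[OF T s])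
    have [measurable]: "T s \<in> borel_measurable M"
      using borel_measurable_integrable[OF integrable_T[OF s]] .
    have "integrable M (\<lambda>x. indicator (ball 0 1) (T s x) *\<^sub>R T s x)"
      by (rule Bochner_Integration.integrable_bound[OF integrable_T[OF s]]) (auto simp: indicator_def)
    moreover have "integrable M (\<lambda>x. indicator (ball 0 1) x *\<^sub>R T s x)"
      using integrable_bounded_linear[OF T.bounded_linear_axioms integrable_small]
      by (simp add: T.scaleR)
    moreover have "(\<integral>x. indicator (ball 0 1) x *\<^sub>R T s x \<partial>M) = T s c"
      unfolding c_def integral_bounded_linear[OF T.bounded_linear_axioms integrable_small, symmetric]
      by (simp add: T.scaleR)
    ultimately show ?thesis
      using s unfolding scaleR_diff_left G_def by (simp add: orbit_eq)
  qed
  have G_set: "set_integrable lborel {0..t} G" for t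
    using G unfolding set_integrable_def by (intro integrable_mult_indicator) auto
  have "drift T b M t = (LINT s:{0..t}|lborel. T s pure_drift) + (LINT s:{0..t}|lborel. G s)" for t
  proof -
    have "drift T b M t = (LINT s:{0..t}|lborel. T s b) + (LINT s:{0..t}|lborel. G s - T s c)"
      unfolding drift_def using inner by (intro arg_cong2[where f = "(+)"] set_lebesgue_integral_cong) auto
    also have "\<dots> = (LINT s:{0..t}|lborel. T s b) + ((LINT s:{0..t}|lborel. G s) - (LINT s:{0..t}|lborel. T s c))"
      by (simp add: set_integral_diff(2)[OF G_set set_integrable_T])
    also have "\<dots> = (LINT s:{0..t}|lborel. T s b - T s c) + (LINT s:{0..t}|lborel. G s)"
      by (simp add: set_integral_diff(2)[OF set_integrable_T set_integrable_T])
    also have "(LINT s:{0..t}|lborel. T s b - T s c) = (LINT s:{0..t}|lborel. T s pure_drift)"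
      by (rule set_lebesgue_integral_cong)
         (auto simp: pure_drift_def c_def linear_diff[OF bounded_linear.linear[OF c0_semigroup_bounded_linear[OF T]]])
    finally show ?thesis .
  qed
  then have "(LINT s:{0..t}|lborel. T s pure_drift) = drift T b M t - (LINT s:{0..t}|lborel. G s)" for t
    by simp
  moreover have "((\<lambda>t. drift T b M t - (LINT s:{0..t}|lborel. G s)) \<longlongrightarrow> b_inf - (\<integral>s. G s \<partial>lborel)) at_top"
    by (intro tendsto_diff assms tendsto_set_integral_Icc G G_neg)
  ultimately show thesis using that by simp
qed

lemma char_fun_mu:
  assumes t: "0 \<le> t"
  shows "char_fun (\<mu> t) \<xi> = exp (\<i> * complex_of_real ((LINT s:{0..t}|lborel. T s pure_drift) \<bullet> \<xi>) +
    (LINT s:{0..t}|lborel. jump_exponent \<xi> s))"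
proof -
  have i1: "set_integrable lborel {0..t} (\<lambda>s. T s pure_drift \<bullet> \<xi>)"
    using integrable_inner_left[OF set_integrable_T[unfolded set_integrable_def]]
    by (simp add: set_integrable_def)
  then have "complex_integrable lborel
      (\<lambda>s. \<i> * complex_of_real (indicator {0..t} s *\<^sub>R (T s pure_drift \<bullet> \<xi>)))"
    unfolding set_integrable_def by (intro integrable_mult_right integrable_of_real)
  then have i1': "set_integrable lborel {0..t} (\<lambda>s. \<i> * complex_of_real (T s pure_drift \<bullet> \<xi>))"
    by (simp add: set_integrable_def scaleR_conv_of_real mult_ac)
  have i2: "set_integrable lborel {0..t} (jump_exponent \<xi>)"
    using integrable_jump_exponent unfolding set_integrable_def
    by (intro integrable_mult_indicator) auto
  have "(LINT s:{0..t}|lborel. levy_symbol b M (adjoint (T s) \<xi>)) =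
      (LINT s:{0..t}|lborel. - (\<i> * complex_of_real (T s pure_drift \<bullet> \<xi>) + jump_exponent \<xi> s))"
    by (rule set_lebesgue_integral_cong) (auto simp: levy_symbol_adjoint)
  also have "\<dots> = - ((LINT s:{0..t}|lborel. \<i> * complex_of_real (T s pure_drift \<bullet> \<xi>)) +
      (LINT s:{0..t}|lborel. jump_exponent \<xi> s))"
    by (simp only: set_integral_uminus[OF set_integral_add(1)[OF i1' i2]] set_integral_add(2)[OF i1' i2])
  also have "(LINT s:{0..t}|lborel. \<i> * complex_of_real (T s pure_drift \<bullet> \<xi>)) =
      \<i> * complex_of_real (LINT s:{0..t}|lborel. T s pure_drift \<bullet> \<xi>)"
    by (simp add: set_integral_complex_of_real)
  also have "(LINT s:{0..t}|lborel. T s pure_drift \<bullet> \<xi>) = (LINT s:{0..t}|lborel. T s pure_drift) \<bullet> \<xi>"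
    using set_integrable_T unfolding set_lebesgue_integral_def set_integrable_def
    by (subst integral_inner_left[symmetric]) auto
  finally show ?thesis using mu t by (simp add: mehler_measures_def add.commute)
qed

section \<open>Passage to the limit in time and the invariant law\<close>

lemma char_fun_mu_tendsto:
  assumes a: "((\<lambda>t. LINT s:{0..t}|lborel. T s pure_drift) \<longlongrightarrow> a) at_top"
  shows "((\<lambda>t. char_fun (\<mu> t) \<xi>) \<longlongrightarrow>
    exp (\<i> * complex_of_real (a \<bullet> \<xi>) + (\<integral>q. iexp (orbit T q \<bullet> \<xi>) - 1 \<partial>Q))) at_top"
proof -
  have "jump_exponent \<xi> s = 0" if "s < 0" for s
    using that by (simp add: jump_exponent_def orbit_def)
  then have "((\<lambda>t. exp (\<i> * complex_of_real ((LINT s:{0..t}|lborel. T s pure_drift) \<bullet> \<xi>) +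
      (LINT s:{0..t}|lborel. jump_exponent \<xi> s))) \<longlongrightarrow>
      exp (\<i> * complex_of_real (a \<bullet> \<xi>) + (\<integral>s. jump_exponent \<xi> s \<partial>lborel))) at_top"
    by (intro tendsto_intros a tendsto_set_integral_Icc integrable_jump_exponent)
  then show ?thesis
    unfolding integral_jump_exponent
    by (rule Lim_transform_eventually)
       (use eventually_ge_at_top[of 0] in eventually_elim, simp add: char_fun_mu)
qed

text \<open>\<open>\<sigma>\<close> is the convolution of its image under \<open>T t\<close> with
  \<open>\<mu> t\<close>. Invariance speaks of real functions, so cosine and sine are tested
  separately.\<close>

lemma char_fun_invariant:
  assumes inv: "invariant_measure (mehler_semigroup T \<mu>) \<sigma>" and t: "0 \<le> t"
  shows "char_fun \<sigma> \<xi> = (\<integral>x. iexp (T t x \<bullet> \<xi>) \<partial>\<sigma>) * char_fun (\<mu> t) \<xi>"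
proof -
  have [measurable_cong]: "sets \<sigma> = sets borel" and "prob_space \<sigma>"
    and P: "\<And>f. f \<in> borel_measurable borel \<Longrightarrow> bounded (range f) \<Longrightarrow>
      (\<integral>x. mehler_semigroup T \<mu> t f x \<partial>\<sigma>) = (\<integral>x. f x \<partial>\<sigma>)"
    using inv t by (auto simp: invariant_measure_def)
  interpret \<sigma>: prob_space \<sigma> by fact
  have [measurable_cong]: "sets (\<mu> t) = sets borel" and "prob_space (\<mu> t)"
    using mu t by (auto simp: mehler_measures_def)
  interpret \<mu>: prob_space "\<mu> t" by fact
  have [measurable]: "T t \<in> borel_measurable borel" using borel_measurable_T[OF t] .
  have shift: "iexp (u \<bullet> \<xi>) * char_fun (\<mu> t) \<xi> = (\<integral>y. iexp ((u + y) \<bullet> \<xi>) \<partial>\<mu> t)" for u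
    unfolding char_fun_def integral_mult_right_zero[symmetric]
    by (simp add: inner_add_left exp_add algebra_simps)
  have int_mu: "complex_integrable (\<mu> t) (\<lambda>y. iexp ((u + y) \<bullet> \<xi>))" for u
    by (rule \<mu>.integrable_const_bound[where B = 1]) auto
  have int_sigma: "complex_integrable \<sigma> (\<lambda>x. iexp (T t x \<bullet> \<xi>) * char_fun (\<mu> t) \<xi>)"
    by (intro integrable_mult_left \<sigma>.integrable_const_bound[where B = 1]) auto
  note int_sigma' = int_sigma[unfolded shift]
  have int_y: "complex_integrable \<sigma> (\<lambda>y. iexp (y \<bullet> \<xi>))"
    by (rule \<sigma>.integrable_const_bound[where B = 1]) auto
  have "Re (\<integral>x. iexp (T t x \<bullet> \<xi>) * char_fun (\<mu> t) \<xi> \<partial>\<sigma>) =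
      (\<integral>x. mehler_semigroup T \<mu> t (\<lambda>y. cos (y \<bullet> \<xi>)) x \<partial>\<sigma>)"
    unfolding shift mehler_semigroup_def integral_Re[OF int_sigma', symmetric] integral_Re[OF int_mu, symmetric]
    by (simp add: Re_exp)
  also have "\<dots> = (\<integral>y. cos (y \<bullet> \<xi>) \<partial>\<sigma>)"
    by (rule P) (auto intro!: boundedI[where B = 1])
  also have "\<dots> = Re (char_fun \<sigma> \<xi>)"
    unfolding char_fun_def integral_Re[OF int_y, symmetric] by (simp add: Re_exp)
  finally have re: "Re (\<integral>x. iexp (T t x \<bullet> \<xi>) * char_fun (\<mu> t) \<xi> \<partial>\<sigma>) = Re (char_fun \<sigma> \<xi>)" .
  have "Im (\<integral>x. iexp (T t x \<bullet> \<xi>) * char_fun (\<mu> t) \<xi> \<partial>\<sigma>) =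
      (\<integral>x. mehler_semigroup T \<mu> t (\<lambda>y. sin (y \<bullet> \<xi>)) x \<partial>\<sigma>)"
    unfolding shift mehler_semigroup_def integral_Im[OF int_sigma', symmetric] integral_Im[OF int_mu, symmetric]
    by (simp add: Im_exp)
  also have "\<dots> = (\<integral>y. sin (y \<bullet> \<xi>) \<partial>\<sigma>)"
    by (rule P) (auto intro!: boundedI[where B = 1])
  also have "\<dots> = Im (char_fun \<sigma> \<xi>)"
    unfolding char_fun_def integral_Im[OF int_y, symmetric] by (simp add: Im_exp)
  finally show ?thesis using re by (simp add: complex_eq_iff)
qed

text \<open>As t grows, stability and dominated convergence send the first factor in
  \<open>char_fun_invariant\<close> to 1, while the left-hand side does not depend on t.\<close>

lemma char_fun_invariant_eq:
  assumes inv: "invariant_measure (mehler_semigroup T \<mu>) \<sigma>"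
    and stable: "\<And>x. ((\<lambda>t. T t x) \<longlongrightarrow> 0) at_top"
    and a: "((\<lambda>t. LINT s:{0..t}|lborel. T s pure_drift) \<longlongrightarrow> a) at_top"
  shows "char_fun \<sigma> \<xi> = exp (\<i> * complex_of_real (a \<bullet> \<xi>) + (\<integral>q. iexp (orbit T q \<bullet> \<xi>) - 1 \<partial>Q))"
proof -
  have [measurable_cong]: "sets \<sigma> = sets borel" and "prob_space \<sigma>"
    using inv by (auto simp: invariant_measure_def)
  interpret \<sigma>: prob_space \<sigma> by fact
  \<comment> \<open>\<open>orbit\<close> replaces \<open>T\<close> because the dominated convergence
    rule asks for measurability at every real t.\<close>
  have "((\<lambda>t. \<integral>x. iexp (orbit T (t, x) \<bullet> \<xi>) \<partial>\<sigma>) \<longlongrightarrow> (\<integral>x. 1 \<partial>\<sigma>)) at_top"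
  proof (rule integral_dominated_convergence_at_top[where w = "\<lambda>_. 1"])
    have "(\<lambda>x. orbit T (t, x)) \<in> borel_measurable borel" for t
      using borel_measurable_orbit[OF T] by measurable
    then show "(\<lambda>x. iexp (orbit T (t, x) \<bullet> \<xi>)) \<in> borel_measurable \<sigma>" for t by measurable
    show "AE x in \<sigma>. ((\<lambda>t. iexp (orbit T (t, x) \<bullet> \<xi>)) \<longlongrightarrow> 1) at_top"
    proof (rule AE_I2)
      fix x
      have "((\<lambda>t. orbit T (t, x)) \<longlongrightarrow> 0) at_top"
        using stable[of x]
        by (rule Lim_transform_eventually)
           (use eventually_ge_at_top[of 0] in eventually_elim, simp add: orbit_eq)
      then have "((\<lambda>t. iexp (orbit T (t, x) \<bullet> \<xi>)) \<longlongrightarrow> iexp (0 \<bullet> \<xi>)) at_top"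
        by (intro tendsto_intros)
      then show "((\<lambda>t. iexp (orbit T (t, x) \<bullet> \<xi>)) \<longlongrightarrow> 1) at_top" by simp
    qed
  qed auto
  then have one: "((\<lambda>t. \<integral>x. iexp (orbit T (t, x) \<bullet> \<xi>) \<partial>\<sigma>) \<longlongrightarrow> 1) at_top"
    by (simp add: \<sigma>.prob_space)
  have "((\<lambda>t. (\<integral>x. iexp (orbit T (t, x) \<bullet> \<xi>) \<partial>\<sigma>) * char_fun (\<mu> t) \<xi>) \<longlongrightarrow>
      1 * exp (\<i> * complex_of_real (a \<bullet> \<xi>) + (\<integral>q. iexp (orbit T q \<bullet> \<xi>) - 1 \<partial>Q))) at_top"
    by (intro tendsto_mult one char_fun_mu_tendsto a)
  then have "((\<lambda>t::real. char_fun \<sigma> \<xi>) \<longlongrightarrow>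
      1 * exp (\<i> * complex_of_real (a \<bullet> \<xi>) + (\<integral>q. iexp (orbit T q \<bullet> \<xi>) - 1 \<partial>Q))) at_top"
    by (rule Lim_transform_eventually)
       (use eventually_ge_at_top[of 0] in eventually_elim, simp add: char_fun_invariant[OF inv] orbit_eq)
  then show ?thesis by (simp add: tendsto_const_iff)
qed

lemma invariant_moment_finite:
  assumes inv: "invariant_measure (mehler_semigroup T \<mu>) \<sigma>"
    and stable: "\<And>x. ((\<lambda>t. T t x) \<longlongrightarrow> 0) at_top"
    and drift: "(drift T b M \<longlongrightarrow> b_inf) at_top"
    and "moment \<sigma> 1 < \<infinity>" and p: "1 \<le> p" "moment M p < \<infinity>"
  shows "moment \<sigma> p < \<infinity>"
proof -
  obtain a where a: "((\<lambda>t. LINT s:{0..t}|lborel. T s pure_drift) \<longlongrightarrow> a) at_top"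
    using pure_drift_tendsto[OF drift] .
  have s: "sets \<sigma> = sets borel" and "prob_space \<sigma>"
    using inv by (auto simp: invariant_measure_def)
  have "integrable \<sigma> (\<lambda>y. y)"
    using assms(4) by (simp add: integrable_iff_bounded moment_def s cong: measurable_cong_sets)
  then interpret jump_law \<sigma> Q "orbit T" a
    using \<open>prob_space \<sigma>\<close> s integrable_orbit char_fun_invariant_eq[OF inv stable a]
      P.sigma_finite_measure_axioms
    by (intro jump_law.intro jump_law_axioms.intro) auto
  show ?thesis
    unfolding moment_def using p moment_orbit_finite by (intro moment_finite) auto
qed

end

theorem proposition4p7:
  fixes T :: "real \<Rightarrow> 'a::{real_inner, banach, second_countable_topology} \<Rightarrow> 'a"
    and b :: 'a and M \<sigma> :: "'a measure" and \<mu> :: "real \<Rightarrow> 'a measure"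
  assumes "c0_semigroup T"
    and "levy_measure M"
    and "continuous_map sazonov_topology euclidean (levy_symbol b M)"
    and "mehler_measures T b M \<mu>"
    and "\<exists>H. orthonormal_basis H \<and> (\<forall>v\<in>H. eigenvector_adj (gen_dom T) (gen T) v)"
    and "(\<integral>\<^sup>+x\<in>- ball 0 1. ennreal (norm x) \<partial>M) < \<infinity>"
    and "\<exists>b_inf. (drift T b M \<longlongrightarrow> b_inf) at_top"
    and "(\<integral>\<^sup>+s\<in>{0..}. (\<integral>\<^sup>+x. ennreal (min 1 ((norm (T s x))\<^sup>2)) \<partial>M) \<partial>lborel) < \<infinity>"
    and "\<forall>x. ((\<lambda>t. T t x) \<longlongrightarrow> 0) at_top"
    and "\<exists>h::real \<Rightarrow> real. (\<forall>t>0. h t > 0) \<and> set_integrable lebesgue {0<..} h \<and>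
           (\<forall>t>0. dominates_image (h t) M (T t))"
    and "invariant_measure (mehler_semigroup T \<mu>) \<sigma>"
    and "moment \<sigma> 1 < \<infinity>" and "moment M 1 < \<infinity>"
  shows "(moment M 2 < \<infinity> \<longrightarrow> moment \<sigma> 2 < \<infinity>) \<and>
         (\<forall>p>2. moment \<sigma> 2 < \<infinity> \<and> moment M p < \<infinity> \<longrightarrow> moment \<sigma> p < \<infinity>)"
proof -
  obtain b_inf where b_inf: "(drift T b M \<longlongrightarrow> b_inf) at_top" using assms(7) by blast
  obtain h :: "real \<Rightarrow> real" where h: "set_integrable lebesgue {0<..} h"
      "\<And>t. 0 < t \<Longrightarrow> dominates_image (h t) M (T t)" using assms(10) by blast
  interpret mehler_jumps M T b \<mu> h
    using assms(1,2,4,13) h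
    by (intro mehler_jumps.intro mehler_jumps_axioms.intro levy_measure_sigma_finite)
       (auto simp: levy_measure_def)
  have "moment \<sigma> p < \<infinity>" if "1 \<le> p" "moment M p < \<infinity>" for p
    using invariant_moment_finite[OF assms(11) _ b_inf assms(12) that] assms(9) by blast
  then show ?thesis by simp
qed

end
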